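(* For every prime power $q$, the class $\mathcal{M}_q$ of $GF(q)$-chordal matroids is closed under taking induced minors: if $M \in \mathcal{M}_q$ and $N$ is an induced minor of $M$, then $N \in \mathcal{M}_q$.
   Context: All matroids are simple; every contraction of a set is immediately followed by simplification. For matroids $M_1,M_2$ whose ground sets meet in a set $T$ that is a modular flat of $M_1$ with $M_1|T=M_2|T=N$, the generalized parallel connection $P_N(M_1,M_2)$ is the matroid on $E(M_1)\cup E(M_2)$ whose flats are the sets $X$ with $X\cap E(M_i)$ a flat of $M_i$ for $i=1,2$ (if $T=\emptyset$ this is $M_1\oplus M_2$). $P_r$ denotes the projective geometry $PG(r-1,q)$. $\mathcal{M}_q$ is the class of matroids that can be built from projective geometries over $GF(q)$ by a sequence of generalized parallel connections across projective geometries over $GF(q)$; its members are called $GF(q)$-chordal. An induced minor of a matroid $M$ is a matroid obtained from $M$ by a sequence of restrictions to flats and contractions (each contraction followed by simplification). *)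

theory Defs
  imports Main
begin

type_synonym 'a matroid = "'a set \<times> ('a set \<Rightarrow> bool)"

definition gr :: "'a matroid \<Rightarrow> 'a set" where "gr M = fst M"
definition indep :: "'a matroid \<Rightarrow> 'a set \<Rightarrow> bool" where "indep M = snd M"

definition matroid :: "'a matroid \<Rightarrow> bool" where
  "matroid M \<longleftrightarrow> finite (gr M) \<and> indep M {} \<and>
     (\<forall>X. indep M X \<longrightarrow> X \<subseteq> gr M) \<and>
     (\<forall>X Y. indep M X \<and> Y \<subseteq> X \<longrightarrow> indep M Y) \<and>
     (\<forall>X Y. indep M X \<and> indep M Y \<and> card X < card Y \<longrightarrow>
        (\<exists>y \<in> Y - X. indep M (insert y X)))"

definition rk :: "'a matroid \<Rightarrow> 'a set \<Rightarrow> nat" where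
  "rk M X = Max (card ` {I. I \<subseteq> X \<and> indep M I})"

definition cl :: "'a matroid \<Rightarrow> 'a set \<Rightarrow> 'a set" where
  "cl M X = {e \<in> gr M. rk M (insert e X) = rk M X}"

definition flat :: "'a matroid \<Rightarrow> 'a set \<Rightarrow> bool" where
  "flat M X \<longleftrightarrow> X \<subseteq> gr M \<and> cl M X = X"

definition simple :: "'a matroid \<Rightarrow> bool" where
  "simple M \<longleftrightarrow> (\<forall>e \<in> gr M. \<forall>f \<in> gr M. indep M {e, f})"

definition restr :: "'a matroid \<Rightarrow> 'a set \<Rightarrow> 'a matroid" where
  "restr M X = (X, \<lambda>I. indep M I \<and> I \<subseteq> X)"

definition contr :: "'a matroid \<Rightarrow> 'a set \<Rightarrow> 'a matroid" where
  "contr M X = (gr M - X, \<lambda>I. I \<subseteq> gr M - X \<and> rk M (I \<union> X) = card I + rk M X)"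

definition is_simplification :: "'a matroid \<Rightarrow> 'a matroid \<Rightarrow> bool" where
  "is_simplification M N \<longleftrightarrow> (\<exists>S. S \<subseteq> gr M \<and> (\<forall>s \<in> S. indep M {s}) \<and>
     (\<forall>e \<in> gr M. indep M {e} \<longrightarrow> (\<exists>!s. s \<in> S \<and> cl M {s} = cl M {e})) \<and>
     N = restr M S)"

definition modular_flat :: "'a matroid \<Rightarrow> 'a set \<Rightarrow> bool" where
  "modular_flat M T \<longleftrightarrow> flat M T \<and>
     (\<forall>F. flat M F \<longrightarrow> rk M T + rk M F = rk M (T \<inter> F) + rk M (T \<union> F))"

definition iso :: "'a matroid \<Rightarrow> 'b matroid \<Rightarrow> bool" where
  "iso M M' \<longleftrightarrow> (\<exists>\<phi>. bij_betw \<phi> (gr M) (gr M') \<and>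
     (\<forall>I. I \<subseteq> gr M \<longrightarrow> (indep M I \<longleftrightarrow> indep M' (\<phi> ` I))))"

text \<open>The projective geometry PG(r-1,F): points are the one-dimensional subspaces of F^r,
  where F^r is represented by the functions nat \<Rightarrow> F vanishing outside {0..<r}; a set of
  points is independent iff chosen nonzero representatives are linearly independent, i.e.
  any vanishing sum of vectors taken from the points consists of zero vectors.\<close>
definition vecs :: "nat \<Rightarrow> (nat \<Rightarrow> 'f::field) set" where
  "vecs r = {v. \<forall>i\<ge>r. v i = 0}"

definition PG_points :: "nat \<Rightarrow> (nat \<Rightarrow> 'f::field) set set" where
  "PG_points r = {{(\<lambda>i. a * v i) | a. True} | v. v \<in> vecs r \<and> v \<noteq> (\<lambda>i. 0)}"

definition PG :: "nat \<Rightarrow> (nat \<Rightarrow> 'f::field) set matroid" where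
  "PG r = (PG_points r, \<lambda>S. S \<subseteq> PG_points r \<and> finite S \<and>
     (\<forall>c. (\<forall>p \<in> S. c p \<in> p) \<longrightarrow> (\<forall>i. (\<Sum>p\<in>S. c p i) = 0) \<longrightarrow> (\<forall>p \<in> S. c p = (\<lambda>i. 0))))"

text \<open>M is (isomorphic to) a projective geometry over the field 'f (including the empty
  geometry PG(-1,F), r = 0).\<close>
definition is_PG :: "'f::{finite,field} itself \<Rightarrow> 'a matroid \<Rightarrow> bool" where
  "is_PG F M \<longleftrightarrow> matroid M \<and> (\<exists>r. iso M (PG r :: (nat \<Rightarrow> 'f) set matroid))"

definition is_gpc :: "'f::{finite,field} itself \<Rightarrow> 'a matroid \<Rightarrow> 'a matroid \<Rightarrow> 'a matroid \<Rightarrow> bool" where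
  "is_gpc F P M1 M2 \<longleftrightarrow>
     (let T = gr M1 \<inter> gr M2 in
       matroid M1 \<and> matroid M2 \<and> simple M1 \<and> simple M2 \<and>
       modular_flat M1 T \<and> restr M1 T = restr M2 T \<and> is_PG F (restr M1 T) \<and>
       matroid P \<and> gr P = gr M1 \<union> gr M2 \<and>
       (\<forall>X. flat P X \<longleftrightarrow> X \<subseteq> gr P \<and> flat M1 (X \<inter> gr M1) \<and> flat M2 (X \<inter> gr M2)))"

inductive chordal :: "'f::{finite,field} itself \<Rightarrow> 'a matroid \<Rightarrow> bool" for F where
  base: "is_PG F M \<Longrightarrow> chordal F M"
| gpc: "chordal F M1 \<Longrightarrow> chordal F M2 \<Longrightarrow> is_gpc F P M1 M2 \<Longrightarrow> chordal F P"

inductive induced_minor :: "'a matroid \<Rightarrow> 'a matroid \<Rightarrow> bool" for M where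
  refl: "induced_minor M M"
| restrict: "induced_minor M N \<Longrightarrow> flat N X \<Longrightarrow> induced_minor M (restr N X)"
| contract: "induced_minor M N \<Longrightarrow> X \<subseteq> gr N \<Longrightarrow> is_simplification (contr N X) N'
             \<Longrightarrow> induced_minor M N'"

end

theory Submission
  imports Defs "HOL-Library.Function_Algebras"
begin

text \<open>
  A simple matroid is determined by its lattice of flats, and an induced minor of \<open>M\<close> is a simple
  matroid whose lattice of flats is isomorphic to an interval \<open>[X, Y]\<close> of the one of \<open>M\<close>. So the
  claim is that intervals of the lattice of a chordal matroid are again lattices of chordal
  matroids. For a projective geometry they are lattices of subspaces of a quotient space. A
  subset of a chordal matroid that is a projective geometry over the same field is a modular flat,
  hence in a generalized parallel connection \<open>P\<close> of \<open>M\<^sub>1\<close> and \<open>M\<^sub>2\<close> both ground sets \<open>E\<^sub>i\<close> are modular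
  flats of \<open>P\<close>. By modularity, intersecting with \<open>E\<^sub>i\<close> is an isomorphism from
  \<open>[X, X \<or> (Y \<and> E\<^sub>i)]\<close> onto \<open>[X \<and> E\<^sub>i, Y \<and> E\<^sub>i]\<close>, so if \<open>N\<close> has the lattice \<open>[X, Y]\<close>, its
  restriction to the flat corresponding to \<open>X \<or> (Y \<and> E\<^sub>i)\<close> is chordal by induction, and \<open>N\<close> is the
  generalized parallel connection of these two restrictions.
\<close>

section \<open>Rank and closure\<close>

text \<open>Simplification picks representatives arbitrarily, so an induced minor has no canonical
  ground set. The induction therefore quantifies over every simple matroid whose lattice of flats is
  isomorphic to the interval, and modularity is treated as a property of the order. That a
  projective subset is a modular flat has two causes. Inside one projective geometry it is a count:
  all lines over GF(q) have q + 1 points, so a subgeometry over the same finite field is a flat, and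
  every flat of a projective geometry is modular. Inside a parallel connection, a projective
  geometry is not the union of two proper flats, so it lies in one of the parts, where induction
  applies, and modularity is transitive. The obstacle is an asymmetry: \<open>is_gpc\<close> makes
  the common part \<open>T\<close> modular in the first matroid only, while modularity of the first
  ground set in \<open>P\<close> rests on modularity of \<open>T\<close> in the second matroid.
  Proving the claim for all projective subsets at once, before any interval is considered, removes
  it: the induction hypothesis applied to \<open>T\<close> inside each part supplies the missing
  modularity.\<close>

context
  fixes M :: "'a matroid"
  assumes M: "matroid M"
begin

lemma finite_gr: "finite (gr M)"
  using M by (simp add: matroid_def)

lemma indep_empty: "indep M {}"
  using M by (simp add: matroid_def)

lemma indep_subset_gr: "indep M I \<Longrightarrow> I \<subseteq> gr M"
  using M by (simp add: matroid_def)

lemma indep_mono: "indep M I \<Longrightarrow> J \<subseteq> I \<Longrightarrow> indep M J"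
  using M[unfolded matroid_def, THEN conjunct2, THEN conjunct2, THEN conjunct2, THEN conjunct1] by blast

lemma indep_augment:
  "indep M I \<Longrightarrow> indep M J \<Longrightarrow> card I < card J \<Longrightarrow> \<exists>y \<in> J - I. indep M (insert y I)"
  using M[unfolded matroid_def, THEN conjunct2, THEN conjunct2, THEN conjunct2, THEN conjunct2] by blast

lemma indep_finite: "indep M I \<Longrightarrow> finite I"
  using finite_subset[OF indep_subset_gr finite_gr] .

lemma finite_card_indeps: "finite (card ` {I. I \<subseteq> X \<and> indep M I})"
proof -
  have "{I. I \<subseteq> X \<and> indep M I} \<subseteq> Pow (gr M)"
    using indep_subset_gr by blast
  then show ?thesis
    using finite_gr by (meson finite_Pow_iff finite_imageI finite_subset)
qed

lemma card_le_rk: "indep M I \<Longrightarrow> I \<subseteq> X \<Longrightarrow> card I \<le> rk M X"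
  unfolding rk_def by (rule Max_ge[OF finite_card_indeps]) auto

lemma rk_attained: "\<exists>I. I \<subseteq> X \<and> indep M I \<and> card I = rk M X"
proof -
  have "card ` {I. I \<subseteq> X \<and> indep M I} \<noteq> {}"
    using indep_empty by auto
  from Max_in[OF finite_card_indeps this] show ?thesis
    unfolding rk_def by auto
qed

lemma indep_extend:
  assumes "indep M I" "I \<subseteq> X"
  shows "\<exists>J. I \<subseteq> J \<and> J \<subseteq> X \<and> indep M J \<and> card J = rk M X"
  using assms
proof (induction "rk M X - card I" arbitrary: I rule: less_induct)
  case less
  show ?case
  proof (cases "card I = rk M X")
    case True
    then show ?thesis using less.prems by blast
  next
    case False
    then have lt: "card I < rk M X"
      using card_le_rk[OF less.prems] by simp
    obtain B where B: "B \<subseteq> X" "indep M B" "card B = rk M X"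
      using rk_attained by blast
    then obtain y where y: "y \<in> B - I" "indep M (insert y I)"
      using indep_augment[OF less.prems(1), of B] lt by auto
    have "card (insert y I) = Suc (card I)"
      using y indep_finite[OF less.prems(1)] by simp
    then have "rk M X - card (insert y I) < rk M X - card I"
      using lt by simp
    moreover have "insert y I \<subseteq> X" using B(1) y(1) less.prems(2) by auto
    ultimately obtain J where "insert y I \<subseteq> J" "J \<subseteq> X" "indep M J" "card J = rk M X"
      using less.hyps[OF _ y(2)] by auto
    then show ?thesis by blast
  qed
qed

lemma rk_mono: "A \<subseteq> B \<Longrightarrow> rk M A \<le> rk M B"
proof -
  assume "A \<subseteq> B"
  moreover obtain I where "I \<subseteq> A" "indep M I" "card I = rk M A"
    using rk_attained by blast
  ultimately show ?thesis using card_le_rk[of I B] by auto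
qed

lemma rk_le_insert: "rk M X \<le> rk M (insert e X)"
  by (rule rk_mono) auto

text \<open>Extend a basis of \<open>A \<inter> B\<close> to a basis \<open>J\<close> of
  \<open>A \<union> B\<close> and count \<open>J\<close> inside \<open>A\<close> and inside
  \<open>B\<close>; elements counted twice lie in \<open>A \<inter> B\<close>.\<close>

lemma rk_submodular: "rk M (A \<union> B) + rk M (A \<inter> B) \<le> rk M A + rk M B"
proof -
  obtain I where I: "I \<subseteq> A \<inter> B" "indep M I" "card I = rk M (A \<inter> B)"
    using rk_attained by blast
  obtain J where J: "I \<subseteq> J" "J \<subseteq> A \<union> B" "indep M J" "card J = rk M (A \<union> B)"
    using indep_extend[OF I(2), of "A \<union> B"] I(1) by blast
  have fin: "finite J" by (rule indep_finite[OF J(3)])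
  have "card (J \<inter> A) \<le> rk M A" "card (J \<inter> B) \<le> rk M B"
    using card_le_rk indep_mono[OF J(3)] by simp_all
  moreover have "card (J \<inter> A) + card (J \<inter> B) = card J + card (J \<inter> A \<inter> B)"
  proof -
    have "J \<inter> A \<union> J \<inter> B = J" "(J \<inter> A) \<inter> (J \<inter> B) = J \<inter> A \<inter> B" using J(2) by auto
    then show ?thesis using card_Un_Int[of "J \<inter> A" "J \<inter> B"] fin by simp
  qed
  moreover have "card I \<le> card (J \<inter> A \<inter> B)"
    using I(1) J(1) fin by (intro card_mono) auto
  ultimately show ?thesis using I(3) J(4) by linarith
qed

lemma rk_le_card: "finite X \<Longrightarrow> rk M X \<le> card X"
proof -
  assume "finite X"
  moreover obtain I where "I \<subseteq> X" "indep M I" "card I = rk M X"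
    using rk_attained by blast
  ultimately show ?thesis using card_mono[of X I] by simp
qed

lemma rk_empty: "rk M {} = 0"
  using rk_le_card[of "{}"] by simp

lemma rk_Un_le: "finite D \<Longrightarrow> rk M (X \<union> D) \<le> rk M X + card D"
  using rk_submodular[of X D] rk_le_card[of D] by linarith

lemma rk_insert_le: "rk M (insert e X) \<le> Suc (rk M X)"
  using rk_Un_le[of "{e}" X] by simp

lemma indep_iff_rk: "I \<subseteq> gr M \<Longrightarrow> indep M I \<longleftrightarrow> rk M I = card I"
proof
  assume "indep M I"
  then show "rk M I = card I"
    using card_le_rk[of I I] rk_le_card indep_finite by (simp add: le_antisym)
next
  assume *: "rk M I = card I" "I \<subseteq> gr M"
  obtain J where J: "J \<subseteq> I" "indep M J" "card J = rk M I"
    using rk_attained by blast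
  have "finite I" using *(2) finite_gr finite_subset by blast
  then have "J = I" using J *(1) by (simp add: card_subset_eq)
  with J show "indep M I" by simp
qed

lemma rk_insert_eq_mono:
  assumes "rk M (insert e X) = rk M X" "X \<subseteq> Y"
  shows "rk M (insert e Y) = rk M Y"
proof (cases "e \<in> Y")
  case True
  then show ?thesis by (simp add: insert_absorb)
next
  case False
  have "insert e X \<union> Y = insert e Y" "insert e X \<inter> Y = X"
    using False assms(2) by auto
  then have "rk M (insert e Y) + rk M X \<le> rk M (insert e X) + rk M Y"
    using rk_submodular[of "insert e X" Y] by simp
  then show ?thesis using assms(1) rk_le_insert[of Y e] by simp
qed

lemma rk_Un_eq:
  assumes "finite D" "\<And>d. d \<in> D \<Longrightarrow> rk M (insert d X) = rk M X"
  shows "rk M (X \<union> D) = rk M X"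
  using assms
proof (induction D)
  case (insert d D)
  then have "rk M (insert d (X \<union> D)) = rk M (X \<union> D)"
    using rk_insert_eq_mono[of d X "X \<union> D"] by blast
  then show ?case using insert by simp
qed simp

section \<open>Closure and flats\<close>

lemma cl_subset_gr: "cl M X \<subseteq> gr M"
  by (auto simp: cl_def)

lemma subset_cl: "X \<subseteq> gr M \<Longrightarrow> X \<subseteq> cl M X"
  by (auto simp: cl_def insert_absorb)

lemma rk_Un_cl: "rk M (X \<union> cl M X) = rk M X"
proof (rule rk_Un_eq)
  show "finite (cl M X)" by (rule finite_subset[OF cl_subset_gr finite_gr])
  show "rk M (insert d X) = rk M X" if "d \<in> cl M X" for d
    using that by (simp only: cl_def mem_Collect_eq)
qed

lemma rk_cl: "X \<subseteq> gr M \<Longrightarrow> rk M (cl M X) = rk M X"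
  using rk_Un_cl[of X] subset_cl[of X] by (simp add: Un_absorb1)

lemma cl_mono: "X \<subseteq> Y \<Longrightarrow> cl M X \<subseteq> cl M Y"
  unfolding cl_def using rk_insert_eq_mono[of _ X Y] by blast

lemma flat_cl: "X \<subseteq> gr M \<Longrightarrow> flat M (cl M X)"
proof -
  assume X: "X \<subseteq> gr M"
  have "cl M (cl M X) \<subseteq> cl M X"
  proof
    fix e assume e: "e \<in> cl M (cl M X)"
    then have "rk M (insert e (cl M X)) = rk M X"
      using rk_cl[OF X] by (simp add: cl_def)
    moreover have "rk M (insert e X) \<le> rk M (insert e (cl M X))"
      using subset_cl[OF X] by (intro rk_mono) auto
    ultimately show "e \<in> cl M X"
      using e rk_le_insert[of X e] by (simp add: cl_def)
  qed
  then show ?thesis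
    using cl_subset_gr subset_cl[of "cl M X"] by (auto simp: flat_def)
qed

lemma flat_gr: "flat M (gr M)"
  using cl_subset_gr[of "gr M"] subset_cl[of "gr M"] by (auto simp: flat_def)

lemma cl_least: "X \<subseteq> F \<Longrightarrow> flat M F \<Longrightarrow> cl M X \<subseteq> F"
  using cl_mono[of X F] by (simp add: flat_def)

lemma flat_Int: "flat M F \<Longrightarrow> flat M G \<Longrightarrow> flat M (F \<inter> G)"
proof -
  assume F: "flat M F" and G: "flat M G"
  then have gr: "F \<inter> G \<subseteq> gr M" by (auto simp: flat_def)
  have "cl M (F \<inter> G) \<subseteq> F" "cl M (F \<inter> G) \<subseteq> G"
    using cl_least[OF _ F] cl_least[OF _ G] by simp_all
  then have "cl M (F \<inter> G) = F \<inter> G" using subset_cl[OF gr] by auto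
  then show ?thesis using gr by (simp add: flat_def)
qed

lemma flat_rk_less:
  assumes "flat M F" "F \<subset> G" "G \<subseteq> gr M"
  shows "rk M F < rk M G"
proof -
  obtain e where e: "e \<in> G - F" using assms(2) by blast
  then have "e \<notin> cl M F" using assms(1) by (simp add: flat_def)
  then have "rk M (insert e F) \<noteq> rk M F" using e assms(3) by (auto simp: cl_def)
  then have "rk M F < rk M (insert e F)" using rk_le_insert[of F e] by simp
  also have "\<dots> \<le> rk M G" using e assms(2) by (intro rk_mono) auto
  finally show ?thesis .
qed

text \<open>The hypothesis is independence of \<open>D\<close> over \<open>T\<close>; adding the
  elements of \<open>D\<close> one at a time then raises the rank by one each time. With
  \<open>T\<close> empty this gives the closure criterion for independence.\<close>

lemma rk_Un_independent:
  assumes "finite D" "D \<subseteq> gr M" "\<And>d. d \<in> D \<Longrightarrow> d \<notin> cl M (T \<union> (D - {d}))"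
  shows "rk M (T \<union> D) = rk M T + card D"
  using assms
proof (induction D)
  case (insert d D)
  have "rk M (T \<union> D) = rk M T + card D"
  proof (rule insert.IH)
    fix x assume x: "x \<in> D"
    have "cl M (T \<union> (D - {x})) \<subseteq> cl M (T \<union> (insert d D - {x}))"
      by (rule cl_mono) auto
    then show "x \<notin> cl M (T \<union> (D - {x}))" using insert.prems(2)[of x] x by blast
  qed (use insert.prems in auto)
  moreover have "insert d D - {d} = D" using insert.hyps by auto
  then have "d \<notin> cl M (T \<union> D)" using insert.prems(2)[of d] by simp
  then have "rk M (insert d (T \<union> D)) \<noteq> rk M (T \<union> D)"
    using insert.prems(1) by (simp add: cl_def)
  then have "rk M (insert d (T \<union> D)) = Suc (rk M (T \<union> D))"
    using rk_insert_le[of d "T \<union> D"] rk_le_insert[of "T \<union> D" d] by simp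
  ultimately show ?case using insert.hyps by simp
qed simp

lemma indep_iff_cl: "I \<subseteq> gr M \<Longrightarrow> indep M I \<longleftrightarrow> (\<forall>i\<in>I. i \<notin> cl M (I - {i}))"
proof
  assume I: "indep M I"
  show "\<forall>i\<in>I. i \<notin> cl M (I - {i})"
  proof
    fix i assume i: "i \<in> I"
    have "rk M (I - {i}) = card (I - {i})" "rk M I = card I"
      using indep_iff_rk indep_mono[OF I, of "I - {i}"] I indep_subset_gr by (simp, blast+)
    then show "i \<notin> cl M (I - {i})"
      using i indep_finite[OF I] card_Diff1_less[of I i] by (auto simp: cl_def insert_absorb)
  qed
next
  assume I: "I \<subseteq> gr M" "\<forall>i\<in>I. i \<notin> cl M (I - {i})"
  then have "rk M ({} \<union> I) = rk M {} + card I"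
    by (intro rk_Un_independent) (auto intro: finite_subset[OF _ finite_gr])
  then show "indep M I" using I indep_iff_rk rk_empty by simp
qed

text \<open>Independence is read off from the flats alone, through flats separating each element
  from the others. This is the form matched with separating subspaces when a projective geometry is
  recognised by its lattice.\<close>

lemma indep_iff_flat:
  "I \<subseteq> gr M \<Longrightarrow> indep M I \<longleftrightarrow> (\<forall>i\<in>I. \<exists>F. flat M F \<and> I - {i} \<subseteq> F \<and> i \<notin> F)"
proof -
  assume I: "I \<subseteq> gr M"
  have "i \<notin> cl M (I - {i}) \<longleftrightarrow> (\<exists>F. flat M F \<and> I - {i} \<subseteq> F \<and> i \<notin> F)" for i
  proof -
    have "I - {i} \<subseteq> gr M" using I by auto
    then show ?thesis
      using flat_cl subset_cl cl_least[of "I - {i}"] by (meson subsetD)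
  qed
  then show ?thesis using indep_iff_cl[OF I] by simp
qed

text \<open>The converse translation: flats are detected by independent sets, which is what
  \<open>iso\<close> preserves. If some \<open>e\<close> outside \<open>F\<close> lay in its
  closure, a basis of \<open>F\<close> together with \<open>e\<close> would exceed the rank.\<close>

lemma flat_iff_indep:
  "flat M F \<longleftrightarrow> F \<subseteq> gr M \<and> (\<forall>I e. I \<subseteq> F \<longrightarrow> indep M I \<longrightarrow> e \<in> gr M - F \<longrightarrow> indep M (insert e I))"
proof (intro iffI conjI allI impI)
  assume F: "flat M F"
  then show "F \<subseteq> gr M" by (simp add: flat_def)
  fix I e assume I: "I \<subseteq> F" "indep M I" and e: "e \<in> gr M - F"
  have "e \<notin> cl M I" using cl_least[OF I(1) F] e by blast
  then have "rk M (insert e I) \<noteq> rk M I" using e by (auto simp: cl_def)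
  then have "rk M (insert e I) = Suc (card I)"
    using rk_insert_le[of e I] rk_le_insert[of I e] indep_iff_rk[of I] I indep_subset_gr by fastforce
  moreover have "e \<notin> I" using I e by auto
  ultimately show "indep M (insert e I)"
    using indep_iff_rk[of "insert e I"] e indep_subset_gr[OF I(2)] indep_finite[OF I(2)] by simp
next
  assume *: "F \<subseteq> gr M \<and> (\<forall>I e. I \<subseteq> F \<longrightarrow> indep M I \<longrightarrow> e \<in> gr M - F \<longrightarrow> indep M (insert e I))"
  obtain I where I: "I \<subseteq> F" "indep M I" "card I = rk M F" using rk_attained by blast
  have "e \<in> F" if e: "e \<in> cl M F" for e
  proof (rule ccontr)
    assume n: "e \<notin> F"
    then have "indep M (insert e I)" using * I e cl_subset_gr by blast
    then have "card (insert e I) \<le> rk M (insert e F)"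
      using I(1) by (intro card_le_rk) auto
    moreover have "e \<notin> I" using n I by auto
    ultimately show False
      using e I indep_finite[OF I(2)] by (simp add: cl_def)
  qed
  then show "flat M F" using * subset_cl[of F] by (auto simp: flat_def)
qed

text \<open>The modular law out of the rank equation. As \<open>A \<subseteq> T\<close>, the sets
  \<open>T \<union> G\<close> and \<open>T \<union> F\<close> have equal rank, so the equations for
  \<open>G\<close> and \<open>F\<close> give
  \<open>rk (T \<inter> G) - rk (T \<inter> F) = rk G - rk F\<close>. Submodularity for
  \<open>H\<close> and \<open>F\<close> bounds this by \<open>rk H - rk (T \<inter> F)\<close>, and
  a flat \<open>H \<subseteq> T \<inter> G\<close> of at least that rank is all of it.\<close>

lemma modular_flat_Un:
  assumes T: "modular_flat M T" and A: "A \<subseteq> T" and F: "flat M F"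
  shows "T \<inter> cl M (A \<union> F) \<subseteq> cl M (A \<union> (T \<inter> F))"
proof -
  have gr: "A \<subseteq> gr M" "F \<subseteq> gr M" "T \<subseteq> gr M" and Tf: "flat M T"
    using assms by (auto simp: modular_flat_def flat_def)
  define G where "G = cl M (A \<union> F)"
  define H where "H = cl M (A \<union> (T \<inter> F))"
  have GH: "flat M G" "flat M H" unfolding G_def H_def using gr by (auto intro!: flat_cl)
  have sub: "A \<union> F \<subseteq> G" unfolding G_def using gr by (intro subset_cl) auto
  have subH: "A \<union> (T \<inter> F) \<subseteq> H" unfolding H_def using gr by (intro subset_cl) auto
  have HT: "H \<subseteq> T" unfolding H_def using A by (intro cl_least Tf) auto
  have HG: "H \<subseteq> G" unfolding G_def H_def by (rule cl_mono) auto
  have HF: "H \<inter> F = T \<inter> F" using HT subH by auto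
  have TG: "rk M T + rk M G = rk M (T \<inter> G) + rk M (T \<union> G)"
    and TF: "rk M T + rk M F = rk M (T \<inter> F) + rk M (T \<union> F)"
    using T GH F by (auto simp: modular_flat_def)
  have eq: "rk M (T \<union> G) = rk M (T \<union> F)"
  proof (rule antisym)
    have "G \<subseteq> cl M (T \<union> F)" unfolding G_def using A by (intro cl_mono) auto
    then have "T \<union> G \<subseteq> cl M (T \<union> F)" using subset_cl[of "T \<union> F"] gr by auto
    then show "rk M (T \<union> G) \<le> rk M (T \<union> F)"
      using rk_mono rk_cl[of "T \<union> F"] gr by (metis Un_subset_iff)
  qed (use sub in \<open>auto intro!: rk_mono\<close>)
  have "rk M (H \<union> F) + rk M (T \<inter> F) \<le> rk M H + rk M F"
    using rk_submodular[of H F] HF by simp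
  moreover have "rk M G \<le> rk M (H \<union> F)"
  proof -
    have "rk M G = rk M (A \<union> F)" unfolding G_def using gr by (intro rk_cl) auto
    then show ?thesis using rk_mono[of "A \<union> F" "H \<union> F"] subH by auto
  qed
  ultimately have le: "rk M (T \<inter> G) \<le> rk M H" using TG TF eq by linarith
  have "H \<subseteq> T \<inter> G" using HT HG by auto
  then have "H = T \<inter> G"
    using flat_rk_less[OF GH(2), of "T \<inter> G"] le gr by fastforce
  then show ?thesis unfolding G_def H_def by simp
qed

end

section \<open>Families of sets ordered by inclusion\<close>

definition flats :: "'a matroid \<Rightarrow> 'a set set" where
  "flats M = {F. flat M F}"

definition ivl :: "'a set set \<Rightarrow> 'a set \<Rightarrow> 'a set \<Rightarrow> 'a set set" where
  "ivl L X Y = {F \<in> L. X \<subseteq> F \<and> F \<subseteq> Y}"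

definition order_iso :: "('a set \<Rightarrow> 'b set) \<Rightarrow> 'a set set \<Rightarrow> 'b set set \<Rightarrow> bool" where
  "order_iso \<Phi> L K \<longleftrightarrow> bij_betw \<Phi> L K \<and> (\<forall>A\<in>L. \<forall>B\<in>L. \<Phi> A \<subseteq> \<Phi> B \<longleftrightarrow> A \<subseteq> B)"

definition isomorphic :: "'a set set \<Rightarrow> 'b set set \<Rightarrow> bool" where
  "isomorphic L K \<longleftrightarrow> (\<exists>\<Phi>. order_iso \<Phi> L K)"

text \<open>Modularity of an element, phrased through the order alone so that order isomorphisms
  preserve it: no two comparable elements have the same join and the same meet with it.\<close>
definition modular_in :: "'a set set \<Rightarrow> 'a set \<Rightarrow> bool" where
  "modular_in L T \<longleftrightarrow> T \<in> L \<and> (\<forall>F\<in>L. \<forall>F'\<in>L. F \<subseteq> F' \<longrightarrow>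
     (\<forall>G\<in>L. T \<subseteq> G \<longrightarrow> F \<subseteq> G \<longrightarrow> F' \<subseteq> G) \<longrightarrow>
     (\<forall>G\<in>L. G \<subseteq> T \<longrightarrow> G \<subseteq> F' \<longrightarrow> G \<subseteq> F) \<longrightarrow> F = F')"

section \<open>Order isomorphisms between families of sets\<close>

lemma order_isoI:
  assumes "\<And>A. A \<in> L \<Longrightarrow> \<Phi> A \<in> K" "\<And>B. B \<in> K \<Longrightarrow> \<Psi> B \<in> L"
    and "\<And>A. A \<in> L \<Longrightarrow> \<Psi> (\<Phi> A) = A" "\<And>B. B \<in> K \<Longrightarrow> \<Phi> (\<Psi> B) = B"
    and "\<And>A B. A \<in> L \<Longrightarrow> B \<in> L \<Longrightarrow> A \<subseteq> B \<Longrightarrow> \<Phi> A \<subseteq> \<Phi> B"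
    and "\<And>A B. A \<in> K \<Longrightarrow> B \<in> K \<Longrightarrow> A \<subseteq> B \<Longrightarrow> \<Psi> A \<subseteq> \<Psi> B"
  shows "order_iso \<Phi> L K"
proof -
  have "bij_betw \<Phi> L K"
    by (rule bij_betw_byWitness[where f' = \<Psi>]) (use assms in auto)
  moreover have "A \<subseteq> B" if "A \<in> L" "B \<in> L" "\<Phi> A \<subseteq> \<Phi> B" for A B
    using assms(6)[of "\<Phi> A" "\<Phi> B"] that assms(1,3) by simp
  ultimately show ?thesis using assms(5) unfolding order_iso_def by blast
qed

lemma order_iso_imageI:
  assumes "\<Phi> ` L = K" and le: "\<And>A B. A \<in> L \<Longrightarrow> B \<in> L \<Longrightarrow> \<Phi> A \<subseteq> \<Phi> B \<longleftrightarrow> A \<subseteq> B"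
  shows "order_iso \<Phi> L K"
proof -
  have "inj_on \<Phi> L"
  proof (rule inj_onI)
    fix A B assume "A \<in> L" "B \<in> L" "\<Phi> A = \<Phi> B"
    then show "A = B" using le[of A B] le[of B A] by simp
  qed
  then show ?thesis using assms unfolding order_iso_def bij_betw_def by simp
qed

lemma order_iso_mem: "order_iso \<Phi> L K \<Longrightarrow> A \<in> L \<Longrightarrow> \<Phi> A \<in> K"
  by (auto simp: order_iso_def bij_betw_def)

lemma order_iso_le: "order_iso \<Phi> L K \<Longrightarrow> A \<in> L \<Longrightarrow> B \<in> L \<Longrightarrow> \<Phi> A \<subseteq> \<Phi> B \<longleftrightarrow> A \<subseteq> B"
  by (auto simp: order_iso_def)

lemma order_iso_inv:
  assumes "order_iso \<Phi> L K"
  shows "order_iso (inv_into L \<Phi>) K L"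
proof -
  have b: "bij_betw \<Phi> L K" using assms by (simp add: order_iso_def)
  have "inv_into L \<Phi> A \<subseteq> inv_into L \<Phi> B \<longleftrightarrow> A \<subseteq> B" if "A \<in> K" "B \<in> K" for A B
    using order_iso_le[OF assms, of "inv_into L \<Phi> A" "inv_into L \<Phi> B"] that
      bij_betw_inv_into_right[OF b] bij_betw_apply[OF bij_betw_inv_into[OF b]] by simp
  then show ?thesis using bij_betw_inv_into[OF b] by (simp add: order_iso_def)
qed

lemma order_iso_surj:
  "order_iso \<Phi> L K \<Longrightarrow> B \<in> K \<Longrightarrow> \<exists>A\<in>L. \<Phi> A = B"
  by (auto simp: order_iso_def bij_betw_def)

lemma isomorphic_sym: "isomorphic L K \<Longrightarrow> isomorphic K L"
  unfolding isomorphic_def using order_iso_inv by blast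

lemma isomorphic_trans [trans]: "isomorphic L K \<Longrightarrow> isomorphic K J \<Longrightarrow> isomorphic L J"
proof -
  assume "isomorphic L K" "isomorphic K J"
  then obtain f g where fg: "order_iso f L K" "order_iso g K J"
    unfolding isomorphic_def by blast
  then have "bij_betw (g \<circ> f) L J" by (auto simp: order_iso_def intro: bij_betw_trans)
  moreover have "g (f A) \<subseteq> g (f B) \<longleftrightarrow> A \<subseteq> B" if "A \<in> L" "B \<in> L" for A B
    using order_iso_le[OF fg(2)] order_iso_mem[OF fg(1)] order_iso_le[OF fg(1)] that by simp
  ultimately have "order_iso (g \<circ> f) L J" unfolding order_iso_def by auto
  then show "isomorphic L J" unfolding isomorphic_def by blast
qed

lemma order_iso_ivl:
  assumes "order_iso \<Phi> L K" "X \<in> L" "Y \<in> L"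
  shows "order_iso \<Phi> (ivl L X Y) (ivl K (\<Phi> X) (\<Phi> Y))"
proof -
  have "\<Phi> ` ivl L X Y = ivl K (\<Phi> X) (\<Phi> Y)"
  proof (intro equalityI subsetI)
    fix B assume B: "B \<in> ivl K (\<Phi> X) (\<Phi> Y)"
    then obtain A where A: "A \<in> L" "B = \<Phi> A" using order_iso_surj[OF assms(1), of B] by (auto simp: ivl_def)
    then have "A \<in> ivl L X Y" using B assms order_iso_le[OF assms(1)] by (simp add: ivl_def)
    then show "B \<in> \<Phi> ` ivl L X Y" using A by blast
  qed (use assms order_iso_le[OF assms(1)] order_iso_mem[OF assms(1)] in \<open>auto simp: ivl_def\<close>)
  moreover have "inj_on \<Phi> (ivl L X Y)"
    using assms(1) by (auto simp: order_iso_def bij_betw_def ivl_def intro: inj_on_subset)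
  ultimately show ?thesis
    using assms(1) by (auto simp: order_iso_def bij_betw_def ivl_def)
qed

lemma ivl_ivl: "X \<subseteq> X' \<Longrightarrow> Y' \<subseteq> Y \<Longrightarrow> ivl (ivl L X Y) X' Y' = ivl L X' Y'"
  by (auto simp: ivl_def)

lemma modular_in_order_iso:
  assumes iso: "order_iso \<Phi> L K" and T: "T \<in> L" and mod: "modular_in K (\<Phi> T)"
  shows "modular_in L T"
  unfolding modular_in_def
proof (intro conjI ballI impI)
  fix F F' assume F: "F \<in> L" "F' \<in> L" "F \<subseteq> F'"
    and j: "\<forall>G\<in>L. T \<subseteq> G \<longrightarrow> F \<subseteq> G \<longrightarrow> F' \<subseteq> G"
    and m: "\<forall>G\<in>L. G \<subseteq> T \<longrightarrow> G \<subseteq> F' \<longrightarrow> G \<subseteq> F"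
  have "\<forall>G\<in>K. \<Phi> T \<subseteq> G \<longrightarrow> \<Phi> F \<subseteq> G \<longrightarrow> \<Phi> F' \<subseteq> G"
    using j F T order_iso_surj[OF iso] order_iso_le[OF iso] by metis
  moreover have "\<forall>G\<in>K. G \<subseteq> \<Phi> T \<longrightarrow> G \<subseteq> \<Phi> F' \<longrightarrow> G \<subseteq> \<Phi> F"
    using m F T order_iso_surj[OF iso] order_iso_le[OF iso] by metis
  ultimately have "\<Phi> F = \<Phi> F'"
    using mod F order_iso_le[OF iso] order_iso_mem[OF iso] unfolding modular_in_def by simp
  then show "F = F'"
    using order_iso_le[OF iso] F by blast
qed (rule T)

section \<open>Modular flats\<close>

text \<open>In the lattice of flats the join with \<open>T\<close> is the closure of the union and
  the meet is the intersection; this puts the order-theoretic condition into matroid terms.\<close>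

lemma modular_inD:
  assumes "matroid M" "modular_in (flats M) T" "flat M F" "flat M F'" "F \<subseteq> F'"
    "F' \<subseteq> cl M (T \<union> F)" "T \<inter> F' \<subseteq> F"
  shows "F = F'"
proof -
  have "\<forall>G\<in>flats M. T \<subseteq> G \<longrightarrow> F \<subseteq> G \<longrightarrow> F' \<subseteq> G"
    using assms(6) cl_least[OF assms(1), of "T \<union> F"] by (auto simp: flats_def)
  moreover have "\<forall>G\<in>flats M. G \<subseteq> T \<longrightarrow> G \<subseteq> F' \<longrightarrow> G \<subseteq> F"
    using assms(7) by auto
  ultimately show ?thesis
    using assms(2-5) unfolding modular_in_def flats_def by blast
qed

lemma modular_inI:
  assumes M: "matroid M" and T: "flat M T"
    and *: "\<And>F F'. flat M F \<Longrightarrow> flat M F' \<Longrightarrow> F \<subseteq> F' \<Longrightarrow> F' \<subseteq> cl M (T \<union> F) \<Longrightarrow> T \<inter> F' \<subseteq> F \<Longrightarrow> F = F'"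
  shows "modular_in (flats M) T"
  unfolding modular_in_def
proof (intro conjI ballI impI)
  fix F F' assume F: "F \<in> flats M" "F' \<in> flats M" "F \<subseteq> F'"
    and j: "\<forall>G\<in>flats M. T \<subseteq> G \<longrightarrow> F \<subseteq> G \<longrightarrow> F' \<subseteq> G"
    and m: "\<forall>G\<in>flats M. G \<subseteq> T \<longrightarrow> G \<subseteq> F' \<longrightarrow> G \<subseteq> F"
  have "T \<union> F \<subseteq> gr M" using T F by (auto simp: flats_def flat_def)
  then have "F' \<subseteq> cl M (T \<union> F)"
    using j flat_cl[OF M, of "T \<union> F"] subset_cl[OF M, of "T \<union> F"] by (simp add: flats_def)
  moreover have "T \<inter> F' \<subseteq> F" using m flat_Int[OF M T, of F'] F by (simp add: flats_def)
  ultimately show "F = F'" using * F by (simp add: flats_def)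
qed (use T in \<open>simp add: flats_def\<close>)

text \<open>Extend a basis \<open>J\<close> of \<open>T \<inter> F\<close> to a basis
  \<open>I\<close> of \<open>F\<close>. The elements of \<open>I - J\<close> turn out independent
  over \<open>T\<close>, so \<open>T \<union> F\<close> has rank at least
  \<open>rk T + rk F - rk (T \<inter> F)\<close>; submodularity is the other inequality.\<close>

lemma modular_in_imp_modular_flat:
  assumes M: "matroid M" and mod: "modular_in (flats M) T"
  shows "modular_flat M T"
  unfolding modular_flat_def
proof (intro conjI allI impI)
  show T: "flat M T" using mod by (simp add: modular_in_def flats_def)
  fix F assume F: "flat M F"
  have gr: "T \<subseteq> gr M" "F \<subseteq> gr M" using T F by (auto simp: flat_def)
  obtain J where J: "J \<subseteq> T \<inter> F" "indep M J" "card J = rk M (T \<inter> F)"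
    using rk_attained[OF M] by blast
  obtain I where I: "J \<subseteq> I" "I \<subseteq> F" "indep M I" "card I = rk M F"
    using indep_extend[OF M J(2), of F] J(1) by blast
  have finI: "finite I" by (rule indep_finite[OF M I(3)])
  have spanJ: "T \<inter> F \<subseteq> cl M J"
  proof
    fix x assume x: "x \<in> T \<inter> F"
    then have "rk M (insert x J) \<le> rk M (T \<inter> F)" using J(1) by (intro rk_mono[OF M]) auto
    moreover have "rk M J = rk M (T \<inter> F)"
      using indep_iff_rk[OF M indep_subset_gr[OF M J(2)]] J by simp
    ultimately show "x \<in> cl M J"
      using x gr rk_le_insert[OF M, of J x] by (auto simp: cl_def)
  qed
  have "rk M (T \<union> (I - J)) = rk M T + card (I - J)"
  proof (rule rk_Un_independent[OF M])
    fix i assume i: "i \<in> I - J"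
    show "i \<notin> cl M (T \<union> (I - J - {i}))"
    proof
      assume icl: "i \<in> cl M (T \<union> (I - J - {i}))"
      \<comment> \<open>If \<open>i\<close> were spanned by \<open>T\<close> and the rest of
        \<open>I - J\<close>, then dropping \<open>i\<close> would give a flat \<open>A\<close>
        below \<open>F\<close> with the same join and the same meet with \<open>T\<close>.
        Modularity forces \<open>A = F\<close>, against the independence of
        \<open>I\<close>.\<close>
      define A where "A = cl M (I - {i})"
      have Igr: "I - {i} \<subseteq> gr M" using I gr by auto
      have Af: "flat M A" unfolding A_def by (rule flat_cl[OF M Igr])
      have AF: "A \<subseteq> F" unfolding A_def using I(2) by (intro cl_least[OF M _ F]) auto
      have sub: "I - {i} \<subseteq> A" unfolding A_def by (rule subset_cl[OF M Igr])
      have TA: "T \<union> A \<subseteq> gr M" using gr AF by auto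
      have "cl M (T \<union> (I - J - {i})) \<subseteq> cl M (T \<union> A)"
        using sub by (intro cl_mono[OF M]) auto
      then have IT: "I \<subseteq> cl M (T \<union> A)"
        using icl sub subset_cl[OF M TA] by blast
      have "F \<subseteq> cl M I"
      proof
        fix x assume x: "x \<in> F"
        then have "rk M (insert x I) \<le> rk M F" using I(2) by (intro rk_mono[OF M]) auto
        moreover have "rk M I = rk M F"
          using indep_iff_rk[OF M indep_subset_gr[OF M I(3)]] I by simp
        ultimately show "x \<in> cl M I"
          using x gr rk_le_insert[OF M, of I x] by (auto simp: cl_def)
      qed
      also have "\<dots> \<subseteq> cl M (T \<union> A)"
        by (rule cl_least[OF M IT flat_cl[OF M TA]])
      finally have "F \<subseteq> cl M (T \<union> A)" .
      moreover have "cl M J \<subseteq> A" unfolding A_def using i I(1) by (intro cl_mono[OF M]) auto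
      then have "T \<inter> F \<subseteq> A" using spanJ by blast
      ultimately have "A = F" using modular_inD[OF M mod Af F AF] by blast
      moreover have "i \<notin> A"
        unfolding A_def using i I(3) indep_iff_cl[OF M indep_subset_gr[OF M I(3)]] by blast
      ultimately show False using i I(2) by blast
    qed
  qed (use finI I(2) gr in auto)
  moreover have "card (I - J) = rk M F - rk M (T \<inter> F)" "rk M (T \<inter> F) \<le> rk M F"
    using I J finI card_Diff_subset[of J I] rk_mono[OF M, of "T \<inter> F" F] by (auto intro: finite_subset)
  moreover have "rk M (T \<union> (I - J)) \<le> rk M (T \<union> F)" using I(2) by (intro rk_mono[OF M]) auto
  ultimately show "rk M T + rk M F = rk M (T \<inter> F) + rk M (T \<union> F)"
    using rk_submodular[OF M, of T F] by linarith
qed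

lemma modular_law_below:
  assumes M: "matroid M" and mod: "modular_in (flats M) T" and A: "A \<subseteq> T" and F: "flat M F"
  shows "T \<inter> cl M (A \<union> F) = cl M (A \<union> (T \<inter> F))"
proof -
  have T: "flat M T" using mod by (simp add: modular_in_def flats_def)
  have "cl M (A \<union> (T \<inter> F)) \<subseteq> T" using A by (intro cl_least[OF M _ T]) auto
  moreover have "cl M (A \<union> (T \<inter> F)) \<subseteq> cl M (A \<union> F)" by (rule cl_mono[OF M]) auto
  ultimately show ?thesis
    using modular_flat_Un[OF M modular_in_imp_modular_flat[OF M mod] A F] by blast
qed

text \<open>The right side is contained in the left side, and the two have the same join and the
  same meet with \<open>T\<close>, so the defining property of \<open>modular_in\<close> identifies
  them.\<close>

lemma modular_law_above:
  assumes M: "matroid M" and mod: "modular_in (flats M) T"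
    and F: "flat M F" and G: "flat M G" and FG: "F \<subseteq> G"
  shows "G \<inter> cl M (T \<union> F) = cl M (F \<union> (G \<inter> T))"
proof -
  have T: "flat M T" using mod by (simp add: modular_in_def flats_def)
  have gr: "T \<subseteq> gr M" "F \<subseteq> gr M" "G \<subseteq> gr M" using T F G by (auto simp: flat_def)
  have gr': "F \<union> (G \<inter> T) \<subseteq> gr M" "T \<union> F \<subseteq> gr M" using gr by auto
  define H where "H = cl M (F \<union> (G \<inter> T))"
  have H: "flat M H" unfolding H_def by (rule flat_cl[OF M gr'(1)])
  have HG: "H \<subseteq> G" unfolding H_def using FG by (intro cl_least[OF M _ G]) auto
  have HT: "H \<subseteq> cl M (T \<union> F)" unfolding H_def by (rule cl_mono[OF M]) auto
  have sub: "F \<union> (G \<inter> T) \<subseteq> H" unfolding H_def by (rule subset_cl[OF M gr'(1)])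
  have "H = G \<inter> cl M (T \<union> F)"
  proof (rule modular_inD[OF M mod H])
    show "flat M (G \<inter> cl M (T \<union> F))" by (intro flat_Int[OF M] G flat_cl[OF M] gr')
    have "cl M (T \<union> F) \<subseteq> cl M (T \<union> H)" using sub by (intro cl_mono[OF M]) auto
    then show "G \<inter> cl M (T \<union> F) \<subseteq> cl M (T \<union> H)" by auto
  qed (use HG HT sub in auto)
  then show ?thesis unfolding H_def by simp
qed

text \<open>A modular element \<open>T\<close> of the whole lattice induces the modular element
  \<open>X \<or> (Y \<and> T)\<close> of the interval from \<open>X\<close> to \<open>Y\<close>:
  equal joins and meets with it inside the interval imply equal joins and meets with
  \<open>T\<close> itself.\<close>

lemma modular_in_ivl:
  assumes M: "matroid M" and mod: "modular_in (flats M) T"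
    and X: "flat M X" and Y: "flat M Y" and XY: "X \<subseteq> Y"
  shows "modular_in (ivl (flats M) X Y) (cl M (X \<union> (Y \<inter> T)))"
proof -
  have T: "flat M T" using mod by (simp add: modular_in_def flats_def)
  have gr: "T \<subseteq> gr M" "X \<subseteq> gr M" "Y \<subseteq> gr M" using T X Y by (auto simp: flat_def)
  have gr': "X \<union> (Y \<inter> T) \<subseteq> gr M" using gr by auto
  define K where "K = cl M (X \<union> (Y \<inter> T))"
  have K: "flat M K" unfolding K_def by (rule flat_cl[OF M gr'])
  have sub: "X \<union> (Y \<inter> T) \<subseteq> K" unfolding K_def by (rule subset_cl[OF M gr'])
  have KY: "K \<subseteq> Y" unfolding K_def using XY by (intro cl_least[OF M _ Y]) auto
  show ?thesis
    unfolding modular_in_def K_def[symmetric]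
  proof (intro conjI ballI impI)
    show "K \<in> ivl (flats M) X Y" using K KY sub by (auto simp: ivl_def flats_def)
    fix F F' assume F: "F \<in> ivl (flats M) X Y" "F' \<in> ivl (flats M) X Y" "F \<subseteq> F'"
      and j: "\<forall>G\<in>ivl (flats M) X Y. K \<subseteq> G \<longrightarrow> F \<subseteq> G \<longrightarrow> F' \<subseteq> G"
      and m: "\<forall>G\<in>ivl (flats M) X Y. G \<subseteq> K \<longrightarrow> G \<subseteq> F' \<longrightarrow> G \<subseteq> F"
    have Ff: "flat M F" "flat M F'" "X \<subseteq> F" "X \<subseteq> F'" "F \<subseteq> Y" "F' \<subseteq> Y"
      using F by (auto simp: ivl_def flats_def)
    have TFgr: "T \<union> F \<subseteq> gr M" using gr Ff by auto
    \<comment> \<open>The join of \<open>T\<close> and \<open>F\<close> may leave the interval; its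
      intersection with \<open>Y\<close> is an upper bound of \<open>K\<close> and \<open>F\<close>
      inside it, so the hypothesis on joins applies.\<close>
    let ?G = "Y \<inter> cl M (T \<union> F)"
    have TF: "T \<union> F \<subseteq> cl M (T \<union> F)" by (rule subset_cl[OF M TFgr])
    have Gf: "flat M ?G" by (intro flat_Int[OF M] Y flat_cl[OF M TFgr])
    have "K \<subseteq> ?G" unfolding K_def using XY TF Ff by (intro cl_least[OF M _ Gf]) auto
    moreover have "?G \<in> ivl (flats M) X Y" using Gf XY TF Ff by (auto simp: ivl_def flats_def)
    moreover have "F \<subseteq> ?G" using TF Ff by auto
    ultimately have "F' \<subseteq> ?G" using j by blast
    then have 1: "F' \<subseteq> cl M (T \<union> F)" by auto
    have "K \<inter> F' \<subseteq> F" using m K sub Ff flat_Int[OF M K Ff(2)] by (auto simp: ivl_def flats_def)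
    then have "T \<inter> F' \<subseteq> F" using sub Ff by auto
    then show "F = F'" using modular_inD[OF M mod Ff(1,2) F(3) 1] by blast
  qed
qed

text \<open>Cut \<open>F\<close> and \<open>F'\<close> down to \<open>A\<close>. The modular law for
  \<open>A\<close> carries the join with \<open>B\<close> into the interval below \<open>A\<close>,
  where modularity of \<open>B\<close> gives \<open>A \<inter> F = A \<inter> F'\<close>; then
  modularity of \<open>A\<close> compares \<open>F\<close> and \<open>F'\<close>.\<close>

lemma modular_in_trans:
  assumes M: "matroid M" and A: "modular_in (flats M) A"
    and B: "modular_in (ivl (flats M) {} A) B"
  shows "modular_in (flats M) B"
proof (rule modular_inI[OF M])
  show Bf: "flat M B" using B by (auto simp: modular_in_def ivl_def flats_def)
  have Af: "flat M A" and BA: "B \<subseteq> A"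
    using A B by (auto simp: modular_in_def ivl_def flats_def)
  fix F F' assume F: "flat M F" "flat M F'" "F \<subseteq> F'" and j: "F' \<subseteq> cl M (B \<union> F)"
    and m: "B \<inter> F' \<subseteq> F"
  have "A \<inter> F = A \<inter> F'"
  proof -
    have mem: "A \<inter> F \<in> ivl (flats M) {} A" "A \<inter> F' \<in> ivl (flats M) {} A"
      using flat_Int[OF M Af] F by (auto simp: ivl_def flats_def)
    have "A \<inter> F' \<subseteq> cl M (B \<union> (A \<inter> F))"
      using j modular_law_below[OF M A BA F(1)] by auto
    then have "\<forall>G\<in>ivl (flats M) {} A. B \<subseteq> G \<longrightarrow> A \<inter> F \<subseteq> G \<longrightarrow> A \<inter> F' \<subseteq> G"
      using cl_least[OF M, of "B \<union> (A \<inter> F)"] by (auto simp: ivl_def flats_def)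
    moreover have "\<forall>G\<in>ivl (flats M) {} A. G \<subseteq> B \<longrightarrow> G \<subseteq> A \<inter> F' \<longrightarrow> G \<subseteq> A \<inter> F"
      using m by auto
    moreover have "A \<inter> F \<subseteq> A \<inter> F'" using F by auto
    ultimately show ?thesis using B mem unfolding modular_in_def by blast
  qed
  moreover have "F' \<subseteq> cl M (A \<union> F)" using j cl_mono[OF M, of "B \<union> F" "A \<union> F"] BA by auto
  ultimately show "F = F'" using modular_inD[OF M A F] by blast
qed

text \<open>The diamond isomorphism, with inverse \<open>G \<mapsto> cl (G \<union> X)\<close>. One
  composition is the identity by the modular law for sets below \<open>T\<close>, the other by the
  law for flats above \<open>X\<close>.\<close>

lemma modular_ivl_iso:
  assumes M: "matroid M" and mod: "modular_in (flats M) T"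
    and X: "flat M X" and Y: "flat M Y" and XY: "X \<subseteq> Y"
  shows "order_iso (\<lambda>F. F \<inter> T) (ivl (flats M) X (cl M (X \<union> (Y \<inter> T)))) (ivl (flats M) (X \<inter> T) (Y \<inter> T))"
proof (rule order_isoI[where \<Psi> = "\<lambda>G. cl M (G \<union> X)"])
  have T: "flat M T" using mod by (simp add: modular_in_def flats_def)
  have gr: "T \<subseteq> gr M" "X \<subseteq> gr M" "Y \<subseteq> gr M" using T X Y by (auto simp: flat_def)
  have low: "T \<inter> cl M (G \<union> X) = G" if "flat M G" "X \<inter> T \<subseteq> G" "G \<subseteq> T" for G
  proof -
    have "G \<union> (T \<inter> X) = G" using that by auto
    then show ?thesis
      using modular_law_below[OF M mod that(3) X] that(1) by (simp add: flat_def)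
  qed
  let ?H = "cl M (X \<union> (Y \<inter> T))"
  have TH: "T \<inter> ?H = Y \<inter> T"
    using low[of "Y \<inter> T"] flat_Int[OF M Y T] XY by (auto simp: Un_commute)
  fix A assume A: "A \<in> ivl (flats M) X ?H"
  show "A \<inter> T \<in> ivl (flats M) (X \<inter> T) (Y \<inter> T)"
    using A TH flat_Int[OF M _ T] by (auto simp: ivl_def flats_def)
  have "cl M (T \<union> X) \<supseteq> ?H" by (rule cl_mono[OF M]) auto
  then have "A \<inter> cl M (T \<union> X) = A" using A by (auto simp: ivl_def)
  moreover have "A \<inter> cl M (T \<union> X) = cl M (X \<union> (A \<inter> T))"
    using A by (intro modular_law_above[OF M mod X]) (auto simp: ivl_def flats_def)
  ultimately show "cl M ((A \<inter> T) \<union> X) = A" by (simp add: Un_commute)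
next
  have T: "flat M T" using mod by (simp add: modular_in_def flats_def)
  have gr: "T \<subseteq> gr M" "X \<subseteq> gr M" "Y \<subseteq> gr M" using T X Y by (auto simp: flat_def)
  fix B assume B: "B \<in> ivl (flats M) (X \<inter> T) (Y \<inter> T)"
  then have Bf: "flat M B" "X \<inter> T \<subseteq> B" "B \<subseteq> Y" "B \<subseteq> T" by (auto simp: ivl_def flats_def)
  have Bgr: "B \<union> X \<subseteq> gr M" using Bf gr by auto
  have "cl M (B \<union> X) \<subseteq> cl M (X \<union> (Y \<inter> T))" using Bf by (intro cl_mono[OF M]) auto
  then show "cl M (B \<union> X) \<in> ivl (flats M) X (cl M (X \<union> (Y \<inter> T)))"
    using flat_cl[OF M Bgr] subset_cl[OF M Bgr] by (auto simp: ivl_def flats_def)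
  have "B \<union> (T \<inter> X) = B" using Bf by auto
  then show "cl M (B \<union> X) \<inter> T = B"
    using modular_law_below[OF M mod Bf(4) X] Bf(1) by (simp add: flat_def Int_commute)
next
  fix A B assume "A \<subseteq> (B :: 'a set)"
  then show "cl M (A \<union> X) \<subseteq> cl M (B \<union> X)" by (intro cl_mono[OF M]) auto
qed auto

section \<open>Restrictions\<close>

lemma gr_restr [simp]: "gr (restr M K) = K"
  by (simp add: restr_def gr_def)

lemma indep_restr [simp]: "indep (restr M K) I \<longleftrightarrow> indep M I \<and> I \<subseteq> K"
  by (simp add: restr_def indep_def)

lemma restr_restr: "J \<subseteq> K \<Longrightarrow> restr (restr M K) J = restr M J"
  by (auto simp: restr_def indep_def)

lemma matroid_restr:
  assumes M: "matroid M" and K: "K \<subseteq> gr M"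
  shows "matroid (restr M K)"
proof -
  have "\<exists>y\<in>J - I. indep M (insert y I) \<and> insert y I \<subseteq> K"
    if "indep M I" "I \<subseteq> K" "indep M J" "J \<subseteq> K" "card I < card J" for I J
    using indep_augment[OF M that(1,3,5)] that by auto
  then show ?thesis
    unfolding matroid_def gr_restr indep_restr
    using finite_subset[OF K finite_gr[OF M]] indep_empty[OF M] indep_mono[OF M] by auto
qed

lemma simple_restr: "simple M \<Longrightarrow> K \<subseteq> gr M \<Longrightarrow> simple (restr M K)"
  by (auto simp: simple_def)

lemma rk_restr: "A \<subseteq> K \<Longrightarrow> rk (restr M K) A = rk M A"
proof -
  assume "A \<subseteq> K"
  then have "{I. I \<subseteq> A \<and> indep (restr M K) I} = {I. I \<subseteq> A \<and> indep M I}" by auto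
  then show ?thesis by (simp only: rk_def)
qed

lemma cl_restr: "A \<subseteq> K \<Longrightarrow> K \<subseteq> gr M \<Longrightarrow> cl (restr M K) A = cl M A \<inter> K"
  by (auto simp: cl_def rk_restr)

lemma flats_restr:
  assumes M: "matroid M" and K: "K \<subseteq> gr M"
  shows "flats (restr M K) = (\<lambda>F. F \<inter> K) ` flats M"
proof (intro equalityI subsetI)
  fix F assume "F \<in> flats (restr M K)"
  then have "F \<subseteq> K" "F = cl (restr M K) F" by (auto simp: flats_def flat_def)
  moreover have "flat M (cl M F)" using \<open>F \<subseteq> K\<close> K by (intro flat_cl[OF M]) auto
  ultimately show "F \<in> (\<lambda>F. F \<inter> K) ` flats M"
    using cl_restr[OF _ K, of F] by (auto simp: flats_def)
next
  fix F assume "F \<in> (\<lambda>F. F \<inter> K) ` flats M"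
  then obtain G where G: "flat M G" "F = G \<inter> K" by (auto simp: flats_def)
  have "F \<subseteq> gr (restr M K)" using G by auto
  moreover have "cl M F \<subseteq> G" using G by (intro cl_least[OF M]) auto
  moreover have "cl (restr M K) F = cl M F \<inter> K" using G K by (intro cl_restr) auto
  ultimately have "flat (restr M K) F"
    unfolding flat_def using G(2) subset_cl[OF matroid_restr[OF M K], of F] by auto
  then show "F \<in> flats (restr M K)" by (simp add: flats_def)
qed

lemma flats_restr_flat:
  assumes M: "matroid M" and K: "flat M K"
  shows "flats (restr M K) = ivl (flats M) {} K"
proof -
  have "K \<subseteq> gr M" using K by (simp add: flat_def)
  then have "flats (restr M K) = (\<lambda>F. F \<inter> K) ` flats M" by (rule flats_restr[OF M])
  also have "\<dots> = ivl (flats M) {} K"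
    using flat_Int[OF M _ K] by (auto simp: ivl_def flats_def)
  finally show ?thesis .
qed

text \<open>Simplicity becomes a condition on the lattice: its bottom is the empty set and its atoms
  are the singletons, which is how elements of the ground set are recovered from flats.\<close>

lemma simple_iff_flats:
  assumes M: "matroid M"
  shows "simple M \<longleftrightarrow> flat M {} \<and> (\<forall>e\<in>gr M. flat M {e})"
proof
  assume s: "simple M"
  have 1: "indep M {e}" if "e \<in> gr M" for e using s that unfolding simple_def by fastforce
  have 2: "indep M {f, e}" if "e \<in> gr M" "f \<in> gr M" for e f using s that unfolding simple_def by blast
  show "flat M {} \<and> (\<forall>e\<in>gr M. flat M {e})"
    unfolding flat_iff_indep[OF M] using 1 2 by (auto simp: subset_singleton_iff)
next
  assume f: "flat M {} \<and> (\<forall>e\<in>gr M. flat M {e})"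
  have 1: "indep M {e}" if "e \<in> gr M" for e
    using f that indep_empty[OF M] unfolding flat_iff_indep[OF M] by auto
  have "indep M {e, f}" if e: "e \<in> gr M" and f': "f \<in> gr M" for e f
  proof (cases "e = f")
    case False
    have "flat M {f}" using f f' by blast
    then show ?thesis
      unfolding flat_iff_indep[OF M] using 1[OF f'] e False by blast
  qed (use 1[OF e] in simp)
  then show "simple M" by (simp add: simple_def)
qed

section \<open>Subspaces and projective geometries\<close>

definition smul :: "'f::field \<Rightarrow> (nat \<Rightarrow> 'f) \<Rightarrow> nat \<Rightarrow> 'f" where
  "smul a v = (\<lambda>i. a * v i)"

definition line :: "(nat \<Rightarrow> 'f::field) \<Rightarrow> (nat \<Rightarrow> 'f) set" where
  "line v = range (\<lambda>a. smul a v)"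

definition subspaces :: "nat \<Rightarrow> (nat \<Rightarrow> 'f::field) set set" where
  "subspaces k = {U. U \<subseteq> vecs k \<and> 0 \<in> U \<and> (\<forall>u\<in>U. \<forall>v\<in>U. u + v \<in> U) \<and> (\<forall>a. \<forall>u\<in>U. smul a u \<in> U)}"

lemma smul_simps [simp]:
  "smul a (u + v) = smul a u + smul a v" "smul (a + b) u = smul a u + smul b u"
  "smul a (smul b u) = smul (a * b) u" "smul 1 u = u" "smul 0 u = 0" "smul a 0 = 0"
  by (auto simp: smul_def fun_eq_iff algebra_simps)

lemma smul_minus: "smul (- 1) u = - u"
  by (auto simp: smul_def fun_eq_iff)

lemma subspaceD:
  assumes "U \<in> subspaces k"
  shows "U \<subseteq> vecs k" "0 \<in> U" "u \<in> U \<Longrightarrow> v \<in> U \<Longrightarrow> u + v \<in> U" "u \<in> U \<Longrightarrow> smul a u \<in> U"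
    "u \<in> U \<Longrightarrow> - u \<in> U" "u \<in> U \<Longrightarrow> v \<in> U \<Longrightarrow> u - v \<in> U"
proof -
  show 1: "U \<subseteq> vecs k" "0 \<in> U" "u \<in> U \<Longrightarrow> v \<in> U \<Longrightarrow> u + v \<in> U" "u \<in> U \<Longrightarrow> smul a u \<in> U" for u v a
    using assms by (auto simp: subspaces_def)
  show 2: "u \<in> U \<Longrightarrow> - u \<in> U" for u using 1(4)[of u "- 1"] by (simp add: smul_minus)
  show "u \<in> U \<Longrightarrow> v \<in> U \<Longrightarrow> u - v \<in> U" using 1(3)[of u "- v"] 2[of v] by simp
qed

lemma vecs_subspace: "vecs k \<in> subspaces k"
  by (auto simp: subspaces_def vecs_def smul_def)

lemma zero_subspace: "{0} \<in> subspaces k"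
  by (auto simp: subspaces_def vecs_def)

lemma subspace_Int: "U \<in> subspaces k \<Longrightarrow> V \<in> subspaces k \<Longrightarrow> U \<inter> V \<in> subspaces k"
  by (auto simp: subspaces_def)

definition subspace_sum :: "(nat \<Rightarrow> 'f::field) set \<Rightarrow> (nat \<Rightarrow> 'f) set \<Rightarrow> (nat \<Rightarrow> 'f) set" where
  "subspace_sum U V = {u + v | u v. u \<in> U \<and> v \<in> V}"

lemma subspace_sum:
  assumes "U \<in> subspaces k" "V \<in> subspaces k"
  shows "subspace_sum U V \<in> subspaces k"
  unfolding subspaces_def mem_Collect_eq
proof (intro conjI ballI allI)
  note U = subspaceD[OF assms(1)] and V = subspaceD[OF assms(2)]
  show "subspace_sum U V \<subseteq> vecs k"
    using U(1) V(1) subspaceD(3)[OF vecs_subspace[of k]] unfolding subspace_sum_def by blast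
  have "0 + 0 \<in> subspace_sum U V" using U(2) V(2) unfolding subspace_sum_def by blast
  then show "0 \<in> subspace_sum U V" by simp
  fix x assume "x \<in> subspace_sum U V"
  then obtain u v where x: "x = u + v" "u \<in> U" "v \<in> V" by (auto simp: subspace_sum_def)
  have "smul a u + smul a v \<in> subspace_sum U V" for a
    using U(4) V(4) x unfolding subspace_sum_def by blast
  then show "smul a x \<in> subspace_sum U V" for a using x by simp
  fix y assume "y \<in> subspace_sum U V"
  then obtain u' v' where y: "y = u' + v'" "u' \<in> U" "v' \<in> V" by (auto simp: subspace_sum_def)
  have "(u + u') + (v + v') \<in> subspace_sum U V"
    using U(3) V(3) x y unfolding subspace_sum_def by blast
  then show "x + y \<in> subspace_sum U V" using x y by (simp add: algebra_simps)
qed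

lemma subspace_sum_left: "0 \<in> V \<Longrightarrow> U \<subseteq> subspace_sum U V"
  unfolding subspace_sum_def by (auto, metis add.right_neutral)

lemma subspace_sum_right: "0 \<in> U \<Longrightarrow> V \<subseteq> subspace_sum U V"
  unfolding subspace_sum_def by (auto, metis add.left_neutral)

lemma subspace_sum_least:
  "U \<subseteq> W \<Longrightarrow> V \<subseteq> W \<Longrightarrow> W \<in> subspaces k \<Longrightarrow> subspace_sum U V \<subseteq> W"
  unfolding subspace_sum_def using subspaceD(3)[of W k] by blast

lemma line_self: "v \<in> line v"
  unfolding line_def by (rule range_eqI[of _ _ 1]) simp

lemma line_subset: "U \<in> subspaces k \<Longrightarrow> line v \<subseteq> U \<longleftrightarrow> v \<in> U"
  using line_self[of v] subspaceD(4)[of U k v] by (auto simp: line_def)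

lemma line_subspace: "v \<in> vecs k \<Longrightarrow> line v \<in> subspaces k"
proof -
  assume v: "v \<in> vecs k"
  have "line v \<subseteq> vecs k" using line_subset[OF vecs_subspace] v by blast
  moreover have "smul 0 v \<in> line v" unfolding line_def by (rule rangeI)
  moreover have "smul a v + smul b v \<in> line v" for a b
    unfolding line_def by (rule range_eqI[of _ _ "a + b"]) simp
  ultimately show ?thesis unfolding subspaces_def by (auto simp: line_def)
qed

lemma line_eq: "w \<in> line v \<Longrightarrow> w \<noteq> 0 \<Longrightarrow> line w = line v"
proof -
  assume "w \<in> line v" "w \<noteq> 0"
  then obtain a where a: "w = smul a v" by (auto simp: line_def)
  then have "a \<noteq> 0" using \<open>w \<noteq> 0\<close> by auto
  have "smul b w = smul (b * a) v" "smul b v = smul (b / a) w" for b using a \<open>a \<noteq> 0\<close> by simp_all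
  then show ?thesis unfolding line_def by blast
qed

section \<open>Points of a projective geometry and their independence\<close>

lemma PG_points_eq: "PG_points k = {line v | v. v \<in> vecs k \<and> v \<noteq> 0}"
  by (auto simp: PG_points_def line_def smul_def zero_fun_def full_SetCompr_eq)

lemma PG_pointE:
  assumes "p \<in> PG_points k"
  obtains v where "v \<in> vecs k" "v \<noteq> 0" "p = line v"
  using assms by (auto simp: PG_points_eq)

lemma PG_point_subspace: "p \<in> PG_points k \<Longrightarrow> p \<in> subspaces k"
  by (auto simp: PG_points_eq line_subspace)

lemma PG_point_line: "p \<in> PG_points k \<Longrightarrow> v \<in> p \<Longrightarrow> v \<noteq> 0 \<Longrightarrow> p = line v"
  by (auto simp: PG_points_eq line_eq)

lemma line_PG_point: "v \<in> vecs k \<Longrightarrow> v \<noteq> 0 \<Longrightarrow> line v \<in> PG_points k"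
  by (auto simp: PG_points_eq)

lemma PG_point_subset_iff:
  "p \<in> PG_points k \<Longrightarrow> v \<in> p \<Longrightarrow> v \<noteq> 0 \<Longrightarrow> U \<in> subspaces k \<Longrightarrow> p \<subseteq> U \<longleftrightarrow> v \<in> U"
  using PG_point_line line_subset by metis

lemma PG_point_antisym: "p \<in> PG_points k \<Longrightarrow> q \<in> PG_points k \<Longrightarrow> p \<subseteq> q \<Longrightarrow> p = q"
  by (metis PG_pointE PG_point_line line_self subsetD)

lemma PG_point_not_zero: "p \<in> PG_points k \<Longrightarrow> \<not> p \<subseteq> {0}"
  using line_self by (auto simp: PG_points_eq)

lemma sum_fun_apply: "(\<Sum>p\<in>S. c p) i = (\<Sum>p\<in>S. c p (i :: nat) :: 'f :: field)"
  by (induction S rule: infinite_finite_induct) auto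

lemma sum_mem_subspace:
  "U \<in> subspaces k \<Longrightarrow> (\<And>p. p \<in> S \<Longrightarrow> c p \<in> U) \<Longrightarrow> (\<Sum>p\<in>S. c p) \<in> U"
  by (induction S rule: infinite_finite_induct) (simp_all add: subspaceD)

lemma gr_PG: "gr (PG k) = PG_points k"
  by (simp add: PG_def gr_def)

lemma indep_PG:
  "indep (PG k) S \<longleftrightarrow> S \<subseteq> PG_points k \<and> finite S \<and>
     (\<forall>c. (\<forall>p\<in>S. c p \<in> p) \<longrightarrow> (\<Sum>p\<in>S. c p) = 0 \<longrightarrow> (\<forall>p\<in>S. c p = 0))"
  by (simp add: PG_def indep_def fun_eq_iff sum_fun_apply)

text \<open>In a vanishing sum the vector chosen from \<open>p\<close> is minus a sum of vectors of
  \<open>U\<close>; a nonzero vector of \<open>p\<close> in \<open>U\<close> would put the whole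
  point into \<open>U\<close>.\<close>

lemma indep_PG_insert:
  fixes k :: nat and U :: "(nat \<Rightarrow> 'f::field) set"
  assumes S: "indep (PG k) S" and U: "U \<in> subspaces k" "\<And>q. q \<in> S \<Longrightarrow> q \<subseteq> U"
    and p: "p \<in> PG_points k" "\<not> p \<subseteq> U"
  shows "indep (PG k) (insert p S)"
  unfolding indep_PG
proof (intro conjI allI impI)
  have pS: "p \<notin> S" using U(2) p by auto
  have fin: "finite S" using S by (simp add: indep_PG)
  show "insert p S \<subseteq> PG_points k" "finite (insert p S)" using S p by (auto simp: indep_PG)
  fix c assume c: "\<forall>q\<in>insert p S. c q \<in> q" and s: "(\<Sum>q\<in>insert p S. c q) = 0"
  have sU: "(\<Sum>q\<in>S. c q) \<in> U" using U c by (intro sum_mem_subspace[OF U(1)]) auto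
  have e: "c p + (\<Sum>q\<in>S. c q) = 0" using s pS fin by simp
  then have "c p = - (\<Sum>q\<in>S. c q)" by (simp add: eq_neg_iff_add_eq_0)
  then have "c p \<in> U" using sU subspaceD(5)[OF U(1)] by simp
  then have cp: "c p = 0" using PG_point_subset_iff[OF p(1) _ _ U(1)] p(2) c by blast
  then have "(\<Sum>q\<in>S. c q) = 0" using e by simp
  then have "\<forall>q\<in>S. c q = 0" using S c unfolding indep_PG by blast
  then show "\<forall>q\<in>insert p S. c q = 0" using cp by simp
qed

text \<open>Linear independence through separating subspaces, the counterpart of
  \<open>indep_iff_flat\<close>. For the forward direction the separating subspace is the span of
  the other points.\<close>

lemma indep_PG_iff:
  fixes S :: "(nat \<Rightarrow> 'f::field) set set"
  shows "indep (PG k) S \<longleftrightarrow> S \<subseteq> PG_points k \<and> finite S \<and>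
     (\<forall>p\<in>S. \<exists>U\<in>subspaces k. (\<forall>q\<in>S - {p}. q \<subseteq> U) \<and> \<not> p \<subseteq> U)"
proof (intro iffI conjI ballI)
  assume S: "indep (PG k) S"
  show pts: "S \<subseteq> PG_points k" and fin: "finite S" using S by (auto simp: indep_PG)
  fix p assume p: "p \<in> S"
  \<comment> \<open>The span of the other points: since each point is closed under scalars, sums
    with one vector chosen from each point already form a subspace.\<close>
  define U where "U = {(\<Sum>q\<in>S - {p}. c q) | c. \<forall>q\<in>S - {p}. c q \<in> q}"
  have UI: "(\<Sum>q\<in>S - {p}. c q) \<in> U" if "\<forall>q\<in>S - {p}. c q \<in> q" for c
    unfolding U_def using that by blast
  have sub: "q \<in> subspaces k" if "q \<in> S" for q using pts PG_point_subspace that by blast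
  have "U \<in> subspaces k"
    unfolding subspaces_def mem_Collect_eq
  proof (intro conjI ballI allI)
    show "U \<subseteq> vecs k"
    proof
      fix u assume "u \<in> U"
      then obtain c where c: "u = (\<Sum>q\<in>S - {p}. c q)" "\<forall>q\<in>S - {p}. c q \<in> q" unfolding U_def by blast
      have "c q \<in> vecs k" if "q \<in> S - {p}" for q using c(2) that subspaceD(1)[OF sub, of q] by auto
      then show "u \<in> vecs k" unfolding c(1) by (intro sum_mem_subspace[OF vecs_subspace])
    qed
    have "\<forall>q\<in>S - {p}. 0 \<in> q" using subspaceD(2)[OF sub] by auto
    then have "(\<Sum>q\<in>S - {p}. 0) \<in> U" by (rule UI)
    then show "0 \<in> U" by simp
    fix u assume "u \<in> U"
    then obtain c where c: "u = (\<Sum>q\<in>S - {p}. c q)" "\<forall>q\<in>S - {p}. c q \<in> q" unfolding U_def by blast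
    have "\<forall>q\<in>S - {p}. smul a (c q) \<in> q" for a
      using c(2) by (simp add: subspaceD(4)[OF sub])
    moreover have "smul a u = (\<Sum>q\<in>S - {p}. smul a (c q))" for a
      by (simp add: c smul_def fun_eq_iff sum_fun_apply sum_distrib_left)
    ultimately show "smul a u \<in> U" for a using UI[of "\<lambda>q. smul a (c q)"] by simp
    fix v assume "v \<in> U"
    then obtain d where d: "v = (\<Sum>q\<in>S - {p}. d q)" "\<forall>q\<in>S - {p}. d q \<in> q" unfolding U_def by blast
    have "\<forall>q\<in>S - {p}. c q + d q \<in> q" using c(2) d(2) by (simp add: subspaceD(3)[OF sub])
    moreover have "u + v = (\<Sum>q\<in>S - {p}. c q + d q)" by (simp add: c d sum.distrib)
    ultimately show "u + v \<in> U" using UI[of "\<lambda>q. c q + d q"] by simp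
  qed
  moreover have "q \<subseteq> U" if q: "q \<in> S - {p}" for q
  proof
    fix v assume v: "v \<in> q"
    define c where "c = (\<lambda>r. if r = q then v else 0)"
    have "\<forall>r\<in>S - {p}. c r \<in> r" unfolding c_def using v subspaceD(2)[OF sub] by auto
    moreover have "(\<Sum>r\<in>S - {p}. c r) = v" unfolding c_def using q fin by (simp add: sum.delta)
    ultimately show "v \<in> U" using UI[of c] by simp
  qed
  moreover have "\<not> p \<subseteq> U"
  proof
    assume pU: "p \<subseteq> U"
    obtain v where v: "v \<in> vecs k" "v \<noteq> 0" "p = line v" using pts p PG_pointE by blast
    then have "v \<in> U" using pU line_self by blast
    then obtain c where c: "v = (\<Sum>q\<in>S - {p}. c q)" "\<forall>q\<in>S - {p}. c q \<in> q" unfolding U_def by blast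
    \<comment> \<open>If \<open>p\<close> lay in the span, its vector \<open>v\<close> would be a
      sum of chosen vectors; taking \<open>- v\<close> from \<open>p\<close> itself turns this into
      a nontrivial dependency of \<open>S\<close>.\<close>
    define d where "d = c(p := - v)"
    have "v \<in> p" using v line_self by blast
    then have "- v \<in> p" by (rule subspaceD(5)[OF sub[OF p]])
    then have "\<forall>q\<in>S. d q \<in> q" using c(2) unfolding d_def by auto
    moreover have "(\<Sum>q\<in>S. d q) = 0"
    proof -
      have "(\<Sum>q\<in>S - {p}. d q) = (\<Sum>q\<in>S - {p}. c q)" unfolding d_def by (rule sum.cong) auto
      then show ?thesis using sum.remove[OF fin p, of d] c(1) by (simp add: d_def)
    qed
    ultimately have "d p = 0" using S p unfolding indep_PG by blast
    then show False using v(2) by (simp add: d_def)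
  qed
  ultimately show "\<exists>U\<in>subspaces k. (\<forall>q\<in>S - {p}. q \<subseteq> U) \<and> \<not> p \<subseteq> U" by blast
next
  assume S: "S \<subseteq> PG_points k \<and> finite S \<and>
     (\<forall>p\<in>S. \<exists>U\<in>subspaces k. (\<forall>q\<in>S - {p}. q \<subseteq> U) \<and> \<not> p \<subseteq> U)"
  have S': "S \<subseteq> PG_points k" "finite S"
    using S by simp_all
  have ex: "\<exists>U\<in>subspaces k. (\<forall>q\<in>S - {p}. q \<subseteq> U) \<and> \<not> p \<subseteq> U" if "p \<in> S" for p
    using S that by blast
  have "c p = 0" if c: "\<forall>p\<in>S. c p \<in> p" and s: "(\<Sum>p\<in>S. c p) = 0" and p: "p \<in> S" for c p
  proof (rule ccontr)
    assume n: "c p \<noteq> 0"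
    obtain U where U: "U \<in> subspaces k" "\<forall>q\<in>S - {p}. q \<subseteq> U" "\<not> p \<subseteq> U" using ex[OF p] by blast
    have sU: "(\<Sum>q\<in>S - {p}. c q) \<in> U" using U c by (intro sum_mem_subspace[OF U(1)]) auto
    have "c p + (\<Sum>q\<in>S - {p}. c q) = 0" using s sum.remove[OF S'(2) p, of c] by simp
    then have "c p = - (\<Sum>q\<in>S - {p}. c q)" by (simp add: eq_neg_iff_add_eq_0)
    then have "c p \<in> U" using sU subspaceD(5)[OF U(1)] by simp
    moreover have "p \<in> PG_points k" "c p \<in> p" using S'(1) p c by auto
    ultimately show False using PG_point_subset_iff[OF _ _ n U(1)] U(3) by blast
  qed
  then show "indep (PG k) S" using S' unfolding indep_PG by blast
qed

text \<open>Write \<open>x \<in> F'\<close> as \<open>t + f\<close> using equality of the joins;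
  then \<open>t = x - f\<close> lies in \<open>T \<inter> F'\<close>, hence in \<open>F\<close> by
  equality of the meets.\<close>

lemma modular_in_subspaces:
  assumes T: "T \<in> subspaces k"
  shows "modular_in (subspaces k) T"
  unfolding modular_in_def
proof (intro conjI ballI impI T)
  fix F F' assume F: "F \<in> subspaces k" "F' \<in> subspaces k" "F \<subseteq> F'"
    and j: "\<forall>G\<in>subspaces k. T \<subseteq> G \<longrightarrow> F \<subseteq> G \<longrightarrow> F' \<subseteq> G"
    and m: "\<forall>G\<in>subspaces k. G \<subseteq> T \<longrightarrow> G \<subseteq> F' \<longrightarrow> G \<subseteq> F"
  have 1: "F' \<subseteq> subspace_sum T F"
    using j subspace_sum[OF T F(1)] subspace_sum_left[of F T] subspace_sum_right[of T F]
      subspaceD(2)[OF T] subspaceD(2)[OF F(1)] by blast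
  have 2: "T \<inter> F' \<subseteq> F" using m subspace_Int[OF T F(2)] by blast
  show "F = F'"
  proof (intro equalityI subsetI)
    fix x assume x: "x \<in> F'"
    then obtain t f where tf: "x = t + f" "t \<in> T" "f \<in> F" using 1 by (auto simp: subspace_sum_def)
    have "x - f \<in> F'" using subspaceD(6)[OF F(2) x] tf F(3) by blast
    then have "t \<in> F" using 2 tf by auto
    then show "x \<in> F" using tf subspaceD(3)[OF F(1)] by simp
  qed (use F(3) in auto)
qed

section \<open>Intervals of the subspace lattice as subspace lattices of quotients\<close>

lemma finite_vecs: "finite (vecs k :: (nat \<Rightarrow> 'f::{finite,field}) set)"
proof -
  have "vecs k = {f :: nat \<Rightarrow> 'f. \<forall>x. (x \<in> {..<k} \<longrightarrow> f x \<in> UNIV) \<and> (x \<notin> {..<k} \<longrightarrow> f x = 0)}"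
    by (auto simp: vecs_def)
  then show ?thesis using finite_set_of_finite_funs[of "{..<k}" "UNIV :: 'f set" "0 :: 'f"] by simp
qed

text \<open>The map \<open>h\<close> is a linear isomorphism from a coordinate space onto a complement of \<open>U\<close> in \<open>V\<close>.\<close>
lemma complement_coordinates:
  fixes U V :: "(nat \<Rightarrow> 'f::{finite,field}) set"
  assumes "U \<in> subspaces k" "V \<in> subspaces k" "U \<subseteq> V"
  shows "\<exists>l h. (\<forall>w\<in>vecs l. h w \<in> V \<and> (h w \<in> U \<longrightarrow> w = 0)) \<and>
     (\<forall>w w'. h (w + w') = h w + h w') \<and> (\<forall>a w. h (smul a w) = smul a (h w)) \<and>
     (\<forall>v\<in>V. \<exists>u\<in>U. \<exists>w\<in>vecs l. v = u + h w)"
  using assms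
\<comment> \<open>All spaces are finite, so the difference of cardinalities serves as the measure in
  place of the codimension; \<open>U\<close> grows by one vector at a time.\<close>
proof (induction "card V - card U" arbitrary: U rule: less_induct)
  case less
  note U = less.prems(1) and V = less.prems(2)
  have finV: "finite V" using subspaceD(1)[OF V] finite_vecs finite_subset by blast
  show ?case
  proof (cases "U = V")
    case True
    have "w = 0" if "w \<in> vecs 0" for w :: "nat \<Rightarrow> 'f" using that by (auto simp: vecs_def)
    then show ?thesis
      using True subspaceD(2)[OF V] subspaceD(2)[OF vecs_subspace]
      by (intro exI[of _ 0] exI[of _ "\<lambda>w. 0"]) fastforce
  next
    case False
    then obtain v where v: "v \<in> V" "v \<notin> U" using less.prems(3) by blast
    have vk: "v \<in> vecs k" using v subspaceD(1)[OF V] by blast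
    define U' where "U' = subspace_sum U (line v)"
    have U': "U' \<in> subspaces k" unfolding U'_def by (rule subspace_sum[OF U line_subspace[OF vk]])
    have "line v \<subseteq> V" using line_subset[OF V] v by blast
    then have U'V: "U' \<subseteq> V" unfolding U'_def using less.prems(3) V subspace_sum_least by blast
    have "U \<subseteq> U'" "line v \<subseteq> U'" unfolding U'_def
      using subspace_sum_left subspace_sum_right subspaceD(2)[OF U] subspaceD(2)[OF line_subspace[OF vk]] by blast+
    then have "U \<subset> U'" using v line_self by blast
    then have "card U < card U'" using U'V finV by (meson finite_subset psubset_card_mono)
    moreover have "card U' \<le> card V" using U'V finV by (simp add: card_mono)
    ultimately have "card V - card U' < card V - card U" by simp
    from less.hyps[OF this U' V U'V] obtain l h
      where h: "\<And>w. w \<in> vecs l \<Longrightarrow> h w \<in> V" "\<And>w. w \<in> vecs l \<Longrightarrow> h w \<in> U' \<Longrightarrow> w = 0"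
        "\<And>w w'. h (w + w') = h w + h w'" "\<And>a w. h (smul a w) = smul a (h w)"
        "\<And>x. x \<in> V \<Longrightarrow> \<exists>u\<in>U'. \<exists>w\<in>vecs l. x = u + h w" by blast
    have h0: "h 0 = 0" using h(4)[of 0 0] by simp
    \<comment> \<open>\<open>h\<close> is known to be injective modulo \<open>U'\<close> only on
      \<open>vecs l\<close>. So the coordinate with index \<open>l\<close> is cut off before
      \<open>h\<close> is applied, and \<open>g\<close> uses it as the multiple of the new vector
      \<open>v\<close>.\<close>
    define tr where "tr = (\<lambda>w :: nat \<Rightarrow> 'f. \<lambda>i. if i < l then w i else 0)"
    have tr: "tr w \<in> vecs l" "tr (w + w') = tr w + tr w'" "tr (smul a w) = smul a (tr w)" for w w' a
      by (auto simp: tr_def vecs_def smul_def fun_eq_iff)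
    define g where "g = (\<lambda>w. h (tr w) + smul (w l) v)"
    have "g w \<in> V" if "w \<in> vecs (Suc l)" for w
      unfolding g_def using h(1)[OF tr(1)] subspaceD(3,4)[OF V] v by blast
    moreover have "w = 0" if w: "w \<in> vecs (Suc l)" and gU: "g w \<in> U" for w
    proof -
      have "h (tr w) = g w + smul (- w l) v"
      proof -
        have "smul (- w l) v = - smul (w l) v" by (simp add: smul_def fun_eq_iff)
        then show ?thesis unfolding g_def by simp
      qed
      also have "\<dots> \<in> U'" unfolding U'_def subspace_sum_def line_def using gU by blast
      finally have t0: "tr w = 0" using h(2)[OF tr(1)] by blast
      have gv: "smul (w l) v \<in> U" using gU t0 h0 unfolding g_def by simp
      have "w l = 0"
      proof (rule ccontr)
        assume "w l \<noteq> 0"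
        then have "v = smul (1 / w l) (smul (w l) v)" by simp
        then show False using subspaceD(4)[OF U gv, of "1 / w l"] v(2) by simp
      qed
      moreover have "w i = 0" if "i < l" for i using t0 that unfolding tr_def fun_eq_iff zero_fun_def by metis
      ultimately show "w = 0" using w unfolding vecs_def fun_eq_iff
        by (auto simp: not_less_eq_eq) (metis linorder_neqE_nat not_less_eq_eq Suc_leI)
    qed
    moreover have "g (w + w') = g w + g w'" for w w'
      unfolding g_def using h(3) tr(2) by (simp add: algebra_simps)
    moreover have "g (smul a w) = smul a (g w)" for a w
    proof -
      have "smul a w l = a * w l" by (simp add: smul_def)
      then show ?thesis unfolding g_def using h(4) tr(3) by simp
    qed
    moreover have "\<exists>u\<in>U. \<exists>w\<in>vecs (Suc l). x = u + g w" if x: "x \<in> V" for x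
    proof -
      obtain u' w where w: "u' \<in> U'" "w \<in> vecs l" "x = u' + h w" using h(5)[OF x] by blast
      obtain u a where u: "u \<in> U" "u' = u + smul a v"
        using w(1) unfolding U'_def subspace_sum_def line_def by blast
      define z where "z = w(l := a)"
      have "z \<in> vecs (Suc l)" using w(2) by (auto simp: z_def vecs_def)
      moreover have "tr z = w" "z l = a" using w(2) by (auto simp: z_def tr_def vecs_def fun_eq_iff)
      then have "x = u + g z" unfolding g_def using w(3) u(2) by (simp add: algebra_simps)
      ultimately show ?thesis using u(1) by blast
    qed
    ultimately show ?thesis by (intro exI[of _ "Suc l"] exI[of _ g]) blast
  qed
qed

text \<open>The interval is the subspace lattice of the quotient \<open>V / U\<close>. The quotient
  is replaced by coordinates on a complement: \<open>W\<close> goes to its preimage under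
  \<open>h\<close>, and \<open>Z\<close> goes back to \<open>U + h(Z)\<close>.\<close>

lemma subspaces_ivl:
  fixes U V :: "(nat \<Rightarrow> 'f::{finite,field}) set"
  assumes U: "U \<in> subspaces k" and V: "V \<in> subspaces k" and UV: "U \<subseteq> V"
  shows "\<exists>l. isomorphic (ivl (subspaces k) U V) (subspaces l :: (nat \<Rightarrow> 'f) set set)"
proof -
  obtain l h where h: "\<And>w. w \<in> vecs l \<Longrightarrow> h w \<in> V" "\<And>w. w \<in> vecs l \<Longrightarrow> h w \<in> U \<Longrightarrow> w = 0"
    "\<And>w w'. h (w + w') = h w + h w'" "\<And>a w. h (smul a w) = smul a (h w)"
    "\<And>x. x \<in> V \<Longrightarrow> \<exists>u\<in>U. \<exists>w\<in>vecs l. x = u + h w"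
    using complement_coordinates[OF assms] by blast
  have h0: "h 0 = 0" using h(4)[of 0 0] by simp
  have hd: "h (w - w') = h w - h w'" for w w' using h(3)[of "w - w'" w'] by simp
  define \<Phi> where "\<Phi> = (\<lambda>W. {w \<in> vecs l. h w \<in> W})"
  define \<Psi> where "\<Psi> = (\<lambda>Z. subspace_sum U (h ` Z))"
  have hZ: "h ` Z \<in> subspaces k" if Z: "Z \<in> subspaces l" for Z
    unfolding subspaces_def mem_Collect_eq
  proof (intro conjI ballI allI)
    show "h ` Z \<subseteq> vecs k" using h(1) subspaceD(1)[OF Z] subspaceD(1)[OF V] by blast
    show "0 \<in> h ` Z" using h0 subspaceD(2)[OF Z] by (metis imageI)
    fix x assume "x \<in> h ` Z"
    then obtain w where w: "x = h w" "w \<in> Z" by blast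
    show "smul a x \<in> h ` Z" for a
      using w h(4)[of a w] subspaceD(4)[OF Z w(2), of a] by (metis imageI)
    fix y assume "y \<in> h ` Z"
    then obtain w' where w': "y = h w'" "w' \<in> Z" by blast
    show "x + y \<in> h ` Z"
      using w w' h(3)[of w w'] subspaceD(3)[OF Z w(2) w'(2)] by (metis imageI)
  qed
  have "order_iso \<Phi> (ivl (subspaces k) U V) (subspaces l)"
  proof (rule order_isoI[where \<Psi> = \<Psi>])
    fix W assume "W \<in> ivl (subspaces k) U V"
    then have W: "W \<in> subspaces k" "U \<subseteq> W" "W \<subseteq> V" by (auto simp: ivl_def)
    show "\<Phi> W \<in> subspaces l"
      unfolding \<Phi>_def subspaces_def
      using h0 h(3,4) subspaceD(2-4)[OF W(1)] subspaceD(2-4)[OF vecs_subspace[of l, where 'a='f]] by simp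
    show "\<Psi> (\<Phi> W) = W"
    proof
      show "\<Psi> (\<Phi> W) \<subseteq> W"
        unfolding \<Psi>_def \<Phi>_def using W by (intro subspace_sum_least) auto
      show "W \<subseteq> \<Psi> (\<Phi> W)"
      proof
        fix x assume x: "x \<in> W"
        then obtain u w where w: "u \<in> U" "w \<in> vecs l" "x = u + h w" using h(5) W(3) by blast
        have "x - u \<in> W" using subspaceD(6)[OF W(1) x] w(1) W(2) by blast
        then have "h w \<in> W" using w(3) by simp
        then show "x \<in> \<Psi> (\<Phi> W)" unfolding \<Psi>_def \<Phi>_def subspace_sum_def using w by blast
      qed
    qed
  next
    fix Z :: "(nat \<Rightarrow> 'f) set" assume Z: "Z \<in> subspaces l"
    have "U \<subseteq> \<Psi> Z" unfolding \<Psi>_def using subspaceD(2)[OF hZ[OF Z]] by (rule subspace_sum_left)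
    moreover have "h ` Z \<subseteq> V" using h(1) subspaceD(1)[OF Z] by blast
    then have "\<Psi> Z \<subseteq> V" unfolding \<Psi>_def using UV V by (intro subspace_sum_least)
    ultimately show "\<Psi> Z \<in> ivl (subspaces k) U V"
      unfolding ivl_def \<Psi>_def using subspace_sum[OF U hZ[OF Z]] by blast
    show "\<Phi> (\<Psi> Z) = Z"
    proof (intro equalityI subsetI)
      fix w assume "w \<in> \<Phi> (\<Psi> Z)"
      then obtain u z where w: "w \<in> vecs l" "h w = u + h z" "u \<in> U" "z \<in> Z"
        unfolding \<Phi>_def \<Psi>_def subspace_sum_def by blast
      have "h (w - z) \<in> U" using hd w by simp
      moreover have "w - z \<in> vecs l"
        using subspaceD(6)[OF vecs_subspace w(1)] w(4) subspaceD(1)[OF Z] by blast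
      ultimately have "w - z = 0" using h(2) by blast
      then show "w \<in> Z" using w(4) by simp
    next
      fix w assume w: "w \<in> Z"
      then have "h w \<in> \<Psi> Z" unfolding \<Psi>_def using subspace_sum_right[OF subspaceD(2)[OF U], of "h ` Z"] by blast
      then show "w \<in> \<Phi> (\<Psi> Z)" unfolding \<Phi>_def using w subspaceD(1)[OF Z] by blast
    qed
  qed (auto simp: \<Phi>_def \<Psi>_def subspace_sum_def)
  then show ?thesis unfolding isomorphic_def by blast
qed

text \<open>A labelling of the elements by projective points under which flats, not independent
  sets, correspond to subspaces; this is the form in which lattices and lines can be
  computed.\<close>

definition coordinates :: "'a matroid \<Rightarrow> nat \<Rightarrow> ('a \<Rightarrow> (nat \<Rightarrow> 'f::field) set) \<Rightarrow> bool" where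
  "coordinates M k \<phi> \<longleftrightarrow> bij_betw \<phi> (gr M) (PG_points k) \<and>
     (\<forall>F. flat M F \<longleftrightarrow> (\<exists>U\<in>subspaces k. F = {e \<in> gr M. \<phi> e \<subseteq> U}))"

section \<open>Projective geometries and their lattices of flats\<close>

lemma is_PG_imp_matroid: "is_PG F M \<Longrightarrow> matroid M"
  by (simp add: is_PG_def)

lemma PG_simple:
  fixes e f :: "(nat \<Rightarrow> 'f::field) set"
  assumes "e \<in> PG_points k" "f \<in> PG_points k"
  shows "indep (PG k) {e, f}"
proof -
  have 0: "indep (PG k) ({} :: (nat \<Rightarrow> 'f) set set)" by (simp add: indep_PG)
  have 1: "indep (PG k) {f}"
    by (rule indep_PG_insert[OF 0 zero_subspace[of k]]) (use assms(2) PG_point_not_zero in auto)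
  show ?thesis
  proof (cases "e = f")
    case False
    have "\<not> e \<subseteq> f" using False PG_point_antisym[OF assms] by auto
    then show ?thesis
      by (intro indep_PG_insert[OF 1 PG_point_subspace[OF assms(2)]] assms(1)) auto
  qed (use 1 in simp)
qed

text \<open>An isomorphism onto \<open>PG k\<close> preserves independence, and flats are translated
  by \<open>flat_iff_indep\<close>. The substantial direction is that the union of the points of a
  flat is a subspace.\<close>

lemma is_PG_coordinates:
  assumes "is_PG TYPE('f::{finite,field}) M"
  shows "simple M" "\<exists>k (\<phi> :: 'a \<Rightarrow> (nat \<Rightarrow> 'f) set). coordinates (M :: 'a matroid) k \<phi>"
proof -
  have M: "matroid M" by (rule is_PG_imp_matroid[OF assms])
  obtain k and \<phi> :: "'a \<Rightarrow> (nat \<Rightarrow> 'f) set" where b: "bij_betw \<phi> (gr M) (PG_points k)"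
    and i: "\<And>I. I \<subseteq> gr M \<Longrightarrow> indep M I \<longleftrightarrow> indep (PG k) (\<phi> ` I)"
    using assms unfolding is_PG_def iso_def gr_PG by blast
  have pt: "\<phi> e \<in> PG_points k" if "e \<in> gr M" for e using bij_betwE[OF b] that by blast
  have inj: "\<phi> e = \<phi> f \<Longrightarrow> e = f" if "e \<in> gr M" "f \<in> gr M" for e f
    using b that by (auto simp: bij_betw_def inj_on_def)
  have surj: "\<exists>e\<in>gr M. \<phi> e = p" if "p \<in> PG_points k" for p
    using that unfolding bij_betw_imp_surj_on[OF b, symmetric] by auto
  show s: "simple M"
    unfolding simple_def using i PG_simple[OF pt pt] by simp
  have "flat M {e \<in> gr M. \<phi> e \<subseteq> U}" if U: "U \<in> subspaces k" for U
    unfolding flat_iff_indep[OF M]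
  proof (intro conjI allI impI)
    fix I e assume I: "I \<subseteq> {e \<in> gr M. \<phi> e \<subseteq> U}" "indep M I" and e: "e \<in> gr M - {e \<in> gr M. \<phi> e \<subseteq> U}"
    have "indep (PG k) (\<phi> ` I)" using i I by auto
    then have "indep (PG k) (insert (\<phi> e) (\<phi> ` I))"
      by (rule indep_PG_insert[OF _ U]) (use I(1) e pt in auto)
    moreover have "insert e I \<subseteq> gr M" using I(1) e by auto
    ultimately show "indep M (insert e I)" using i[of "insert e I"] by simp
  qed auto
  moreover have "\<exists>U\<in>subspaces k. F = {e \<in> gr M. \<phi> e \<subseteq> U}" if F: "flat M F" for F
  proof
    have Fgr: "F \<subseteq> gr M" using F by (simp add: flat_def)
    \<comment> \<open>The zero vector is added for the empty flat, which has no points to contribute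
      it.\<close>
    let ?U = "insert 0 (\<Union>(\<phi> ` F))"
    have sub: "\<phi> e \<in> subspaces k" if "e \<in> F" for e
      using PG_point_subspace[OF pt] that Fgr by auto
    have add: "u + v \<in> ?U" if u: "u \<in> \<phi> e" "e \<in> F" and v: "v \<in> \<phi> f" "f \<in> F" for u v e f
    proof (cases "u = 0 \<or> v = 0 \<or> u + v = 0 \<or> e = f")
      case True
      then show ?thesis
      proof (elim disjE)
        assume "e = f"
        then have "u + v \<in> \<phi> e" using subspaceD(3)[OF sub[OF u(2)] u(1)] v(1) by simp
        then show ?thesis using u(2) by auto
      qed (use u v in auto)
    next
      case False
      have "u \<in> vecs k" "v \<in> vecs k" using u v subspaceD(1)[OF sub] by (meson subsetD)+
      then have uv: "u + v \<in> vecs k" by (rule subspaceD(3)[OF vecs_subspace])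
      then obtain g where g: "g \<in> gr M" "\<phi> g = line (u + v)"
        using surj[OF line_PG_point] False by blast
      \<comment> \<open>Were the point \<open>g\<close> of \<open>u + v\<close> outside the flat, it
        would be independent of \<open>e\<close> and \<open>f\<close>; but a subspace containing the
        points of \<open>u\<close> and \<open>v\<close> also contains that of
        \<open>u + v\<close>.\<close>
      have "g \<in> F"
      proof (rule ccontr)
        assume n: "g \<notin> F"
        have ef: "e \<in> gr M" "f \<in> gr M" using u v Fgr by auto
        have "indep M {e, f}" using s ef by (simp add: simple_def)
        moreover have "g \<in> gr M - F" "{e, f} \<subseteq> F" using g n u v by auto
        ultimately have "indep M {g, e, f}" using F unfolding flat_iff_indep[OF M] by blast
        then have "indep (PG k) (\<phi> ` {g, e, f})" using i[of "{g, e, f}"] g ef by blast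
        then have "indep (PG k) {\<phi> g, \<phi> e, \<phi> f}" by simp
        then have "\<forall>p\<in>{\<phi> g, \<phi> e, \<phi> f}. \<exists>U\<in>subspaces k. (\<forall>q\<in>{\<phi> g, \<phi> e, \<phi> f} - {p}. q \<subseteq> U) \<and> \<not> p \<subseteq> U"
          unfolding indep_PG_iff by (elim conjE)
        from bspec[OF this insertI1] obtain U
          where U: "U \<in> subspaces k" "\<forall>q\<in>{\<phi> g, \<phi> e, \<phi> f} - {\<phi> g}. q \<subseteq> U" "\<not> \<phi> g \<subseteq> U"
          by (elim bexE conjE)
        have "\<phi> e \<noteq> \<phi> g" "\<phi> f \<noteq> \<phi> g" using inj[of e g] inj[of f g] g(1) ef n u(2) v(2) by auto
        then have "u \<in> U" "v \<in> U" using U(2) u(1) v(1) by auto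
        then have "u + v \<in> U" by (rule subspaceD(3)[OF U(1)])
        then show False using U(3) g(2) line_subset[OF U(1)] by blast
      qed
      then show ?thesis using g(2) line_self by auto
    qed
    show U: "?U \<in> subspaces k"
      unfolding subspaces_def mem_Collect_eq
    proof (intro conjI ballI allI)
      show "?U \<subseteq> vecs k"
        using subspaceD(1)[OF sub] subspaceD(2)[OF vecs_subspace] by auto
      fix u assume u: "u \<in> ?U"
      show "smul a u \<in> ?U" for a using u subspaceD(4)[OF sub] by auto
      fix v assume v: "v \<in> ?U"
      show "u + v \<in> ?U"
      proof (cases "u = 0 \<or> v = 0")
        case False
        then show ?thesis using u v add by blast
      qed (use u v in auto)
    qed simp
    have "e \<in> F" if e: "e \<in> gr M" "\<phi> e \<subseteq> ?U" for e
    proof -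
      obtain v where v: "v \<noteq> 0" "\<phi> e = line v" using pt[OF e(1)] PG_pointE by blast
      then have "v \<in> ?U" using e(2) line_self by blast
      then obtain f where f: "f \<in> F" "v \<in> \<phi> f" using v(1) by blast
      then have "\<phi> f = \<phi> e" using PG_point_line[OF pt _ v(1), of f] Fgr v(2) by auto
      then show "e \<in> F" using inj[of f e] f(1) Fgr e(1) by auto
    qed
    then show "F = {e \<in> gr M. \<phi> e \<subseteq> ?U}" using Fgr by auto
  qed
  ultimately have "coordinates M k \<phi>" unfolding coordinates_def using b by blast
  then show "\<exists>k (\<phi> :: 'a \<Rightarrow> (nat \<Rightarrow> 'f) set). coordinates M k \<phi>" by blast
qed

context
  fixes M :: "'a matroid" and k :: nat and \<phi> :: "'a \<Rightarrow> (nat \<Rightarrow> 'f::field) set"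
  assumes c: "coordinates M k \<phi>"
begin

lemma coordinates_point: "e \<in> gr M \<Longrightarrow> \<phi> e \<in> PG_points k"
  using c bij_betw_apply[of \<phi> "gr M" "PG_points k" e] by (simp add: coordinates_def)

lemma coordinates_subspace: "e \<in> gr M \<Longrightarrow> \<phi> e \<in> subspaces k"
  by (rule PG_point_subspace[OF coordinates_point])

lemma coordinates_inj: "e \<in> gr M \<Longrightarrow> f \<in> gr M \<Longrightarrow> \<phi> e = \<phi> f \<Longrightarrow> e = f"
  using c by (auto simp: coordinates_def bij_betw_def inj_on_def)

lemma coordinates_line: "v \<in> vecs k \<Longrightarrow> v \<noteq> 0 \<Longrightarrow> \<exists>e\<in>gr M. \<phi> e = line v"
proof -
  assume "v \<in> vecs k" "v \<noteq> 0"
  then have "line v \<in> \<phi> ` gr M"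
    using c line_PG_point unfolding coordinates_def bij_betw_def by simp
  then show ?thesis by auto
qed

lemma coordinates_vector: "e \<in> gr M \<Longrightarrow> \<exists>v. v \<in> vecs k \<and> v \<noteq> 0 \<and> \<phi> e = line v"
  using coordinates_point[of e] by (auto simp: PG_points_eq)

lemma coordinates_flat: "U \<in> subspaces k \<Longrightarrow> flat M {e \<in> gr M. \<phi> e \<subseteq> U}"
  using c by (auto simp: coordinates_def)

lemma coordinates_flatE: "flat M F \<Longrightarrow> \<exists>U\<in>subspaces k. F = {e \<in> gr M. \<phi> e \<subseteq> U}"
  using c by (simp add: coordinates_def)

lemma coordinates_mono_iff:
  assumes U: "U \<in> subspaces k" and V: "V \<in> subspaces k"
  shows "{e \<in> gr M. \<phi> e \<subseteq> U} \<subseteq> {e \<in> gr M. \<phi> e \<subseteq> V} \<longleftrightarrow> U \<subseteq> V"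
proof
  assume *: "{e \<in> gr M. \<phi> e \<subseteq> U} \<subseteq> {e \<in> gr M. \<phi> e \<subseteq> V}"
  show "U \<subseteq> V"
  proof
    fix v assume v: "v \<in> U"
    show "v \<in> V"
    proof (cases "v = 0")
      case False
      have "v \<in> vecs k" using v subspaceD(1)[OF U] by blast
      from coordinates_line[OF this False] obtain e where e: "e \<in> gr M" "\<phi> e = line v" by blast
      then have "\<phi> e \<subseteq> V" using * v line_subset[OF U, of v] by auto
      then show ?thesis using e(2) line_subset[OF V, of v] by simp
    qed (simp add: subspaceD(2)[OF V])
  qed
qed auto

lemma coordinates_isomorphic: "isomorphic (flats M) (subspaces k :: (nat \<Rightarrow> 'f) set set)"
proof (rule isomorphic_sym)
  let ?\<Phi> = "\<lambda>U. {e \<in> gr M. \<phi> e \<subseteq> U}"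
  have "?\<Phi> ` subspaces k = flats M"
  proof (intro equalityI subsetI)
    fix F assume "F \<in> flats M"
    then show "F \<in> ?\<Phi> ` subspaces k" using coordinates_flatE[of F] unfolding flats_def by blast
  qed (auto simp: flats_def coordinates_flat)
  then have "order_iso ?\<Phi> (subspaces k) (flats M)"
    by (rule order_iso_imageI[OF _ coordinates_mono_iff])
  then show "isomorphic (subspaces k :: (nat \<Rightarrow> 'f) set set) (flats M)" unfolding isomorphic_def by blast
qed

end

text \<open>An order isomorphism matches the atoms: singletons, as \<open>M\<close> is simple, with
  projective points. Independence then agrees because on both sides it is expressed by separating
  flats or subspaces.\<close>

lemma isomorphic_imp_is_PG:
  fixes M :: "'a matroid"
  assumes M: "matroid M" "simple M" and
    isoM: "isomorphic (flats M) (subspaces k :: (nat \<Rightarrow> 'f::{finite,field}) set set)"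
  shows "is_PG TYPE('f) M"
proof -
  obtain \<Phi> :: "'a set \<Rightarrow> (nat \<Rightarrow> 'f) set" where \<Phi>: "order_iso \<Phi> (flats M) (subspaces k)"
    using isoM unfolding isomorphic_def by blast
  note le = order_iso_le[OF \<Phi>] and mem = order_iso_mem[OF \<Phi>] and surj = order_iso_surj[OF \<Phi>]
  have e0: "{} \<in> flats M" and e1: "e \<in> gr M \<Longrightarrow> {e} \<in> flats M" for e
    using simple_iff_flats[OF M(1)] M(2) by (auto simp: flats_def)
  have F_gr: "F \<subseteq> gr M" if "F \<in> flats M" for F using that by (auto simp: flats_def flat_def)
  have \<Phi>0: "\<Phi> {} = {0}"
  proof -
    obtain A where A: "A \<in> flats M" "\<Phi> A = {0}" using surj[OF zero_subspace] by blast
    then have "\<Phi> {} \<subseteq> {0}" using le[OF e0 A(1)] by simp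
    then show ?thesis using subspaceD(2)[OF mem[OF e0]] by auto
  qed
  define \<phi> where "\<phi> = (\<lambda>e. \<Phi> {e})"
  have sub: "\<phi> e \<in> subspaces k" if "e \<in> gr M" for e unfolding \<phi>_def by (rule mem[OF e1[OF that]])
  \<comment> \<open>A flat sent to a line is nonempty, because the empty flat is sent to the zero
    space; each of its elements gives a subspace inside the line.\<close>
  have line_flat: "\<exists>e\<in>F. \<phi> e \<subseteq> line v" if F: "F \<in> flats M" "\<Phi> F = line v" "v \<noteq> 0" for F v
  proof -
    have "F \<noteq> {}" using F \<Phi>0 line_self[of v] by auto
    then obtain e where e: "e \<in> F" by blast
    then have "e \<in> gr M" using F_gr[OF F(1)] by auto
    then have "\<phi> e \<subseteq> line v" unfolding \<phi>_def F(2)[symmetric] using le[OF e1 F(1)] e by simp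
    then show ?thesis using e by blast
  qed
  \<comment> \<open>Choose a line inside \<open>\<phi> e\<close>. The flat mapped to it is nonempty
    and contained in \<open>{e}\<close>, so it equals \<open>{e}\<close> and \<open>\<phi> e\<close>
    is that line.\<close>
  have pt: "\<phi> e \<in> PG_points k" if e: "e \<in> gr M" for e
  proof -
    have "\<not> \<phi> e \<subseteq> {0}" unfolding \<phi>_def \<Phi>0[symmetric] using le[OF e1[OF e] e0] by simp
    then obtain v where v: "v \<in> \<phi> e" "v \<noteq> 0" by blast
    have vk: "v \<in> vecs k" using v(1) subspaceD(1)[OF sub[OF e]] by blast
    obtain F where F: "F \<in> flats M" "\<Phi> F = line v" using surj[OF line_subspace[OF vk]] by blast
    obtain f where f: "f \<in> F" "\<phi> f \<subseteq> line v" using line_flat[OF F v(2)] by blast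
    have "line v \<subseteq> \<phi> e" using line_subset[OF sub[OF e]] v(1) by blast
    then have "F \<subseteq> {e}" using le[OF F(1) e1[OF e]] F(2) by (simp add: \<phi>_def)
    then have "F = {e}" using f(1) by auto
    then have "\<phi> e = line v" using F(2) by (simp add: \<phi>_def)
    then show ?thesis using line_PG_point[OF vk v(2)] by simp
  qed
  have inj: "inj_on \<phi> (gr M)"
  proof (rule inj_onI)
    fix e f assume "e \<in> gr M" "f \<in> gr M" "\<phi> e = \<phi> f"
    then have "{e} \<subseteq> {f}" using le[OF e1 e1, of e f] by (simp add: \<phi>_def)
    then show "e = f" by simp
  qed
  have "p \<in> \<phi> ` gr M" if p: "p \<in> PG_points k" for p
  proof -
    obtain F where F: "F \<in> flats M" "\<Phi> F = p" using surj[OF PG_point_subspace[OF p]] by blast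
    obtain v where v: "v \<noteq> 0" "p = line v" using p PG_pointE by blast
    obtain e where e: "e \<in> F" "\<phi> e \<subseteq> p" using line_flat[OF F(1)] F(2) v by blast
    have eg: "e \<in> gr M" using e(1) F_gr[OF F(1)] by auto
    then have "\<phi> e = p" using PG_point_antisym[OF pt p e(2)] by simp
    then show ?thesis using eg by blast
  qed
  then have bij: "bij_betw \<phi> (gr M) (PG_points k)"
    unfolding bij_betw_def using inj pt by auto
  have le1: "\<phi> e \<subseteq> \<Phi> F \<longleftrightarrow> e \<in> F" if "e \<in> gr M" "F \<in> flats M" for e F
    unfolding \<phi>_def using le[OF e1 that(2)] that(1) by simp
  have "indep M I \<longleftrightarrow> indep (PG k) (\<phi> ` I)" if I: "I \<subseteq> gr M" for I
  proof -
    have img: "\<phi> ` I - {\<phi> i} = \<phi> ` (I - {i})" if "i \<in> I" for i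
      using inj I that by (auto simp: inj_on_def)
    have step: "(\<exists>F. flat M F \<and> I - {i} \<subseteq> F \<and> i \<notin> F) \<longleftrightarrow>
        (\<exists>U\<in>subspaces k. (\<forall>q\<in>\<phi> ` (I - {i}). q \<subseteq> U) \<and> \<not> \<phi> i \<subseteq> U)" if i: "i \<in> I" for i
    proof
      assume "\<exists>F. flat M F \<and> I - {i} \<subseteq> F \<and> i \<notin> F"
      then obtain F where F: "F \<in> flats M" "I - {i} \<subseteq> F" "i \<notin> F" by (auto simp: flats_def)
      show "\<exists>U\<in>subspaces k. (\<forall>q\<in>\<phi> ` (I - {i}). q \<subseteq> U) \<and> \<not> \<phi> i \<subseteq> U"
        using le1[OF _ F(1)] I F i mem[OF F(1)] by (intro bexI[of _ "\<Phi> F"]) auto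
    next
      assume "\<exists>U\<in>subspaces k. (\<forall>q\<in>\<phi> ` (I - {i}). q \<subseteq> U) \<and> \<not> \<phi> i \<subseteq> U"
      then obtain U where U: "U \<in> subspaces k" "\<forall>q\<in>\<phi> ` (I - {i}). q \<subseteq> U" "\<not> \<phi> i \<subseteq> U" by blast
      obtain F where F: "F \<in> flats M" "\<Phi> F = U" using surj[OF U(1)] by blast
      have "j \<in> F" if "j \<in> I - {i}" for j using le1[of j F] F U(2) that I by auto
      moreover have "i \<notin> F" using le1[of i F] F U(3) i I by auto
      ultimately show "\<exists>F. flat M F \<and> I - {i} \<subseteq> F \<and> i \<notin> F"
        using F(1) by (intro exI[of _ F]) (auto simp: flats_def)
    qed
    have "finite I" using I finite_gr[OF M(1)] finite_subset by blast
    moreover have "\<phi> ` I \<subseteq> PG_points k" using pt I by auto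
    moreover have "indep M I \<longleftrightarrow> (\<forall>i\<in>I. \<exists>F. flat M F \<and> I - {i} \<subseteq> F \<and> i \<notin> F)"
      by (rule indep_iff_flat[OF M(1) I])
    ultimately show ?thesis
      unfolding indep_PG_iff using step img by simp
  qed
  then have "iso M (PG k :: (nat \<Rightarrow> 'f) set matroid)"
    unfolding iso_def gr_PG using bij by blast
  then show ?thesis unfolding is_PG_def using M(1) by blast
qed

lemma is_PG_iff:
  fixes M :: "'a matroid"
  assumes "matroid M"
  shows "is_PG TYPE('f::{finite,field}) M \<longleftrightarrow>
    simple M \<and> (\<exists>k. isomorphic (flats M) (subspaces k :: (nat \<Rightarrow> 'f) set set))"
proof
  assume M: "is_PG TYPE('f) M"
  obtain k and \<phi> :: "'a \<Rightarrow> (nat \<Rightarrow> 'f) set" where "coordinates M k \<phi>"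
    using is_PG_coordinates(2)[OF M] by blast
  then show "simple M \<and> (\<exists>k. isomorphic (flats M) (subspaces k :: (nat \<Rightarrow> 'f) set set))"
    using is_PG_coordinates(1)[OF M] coordinates_isomorphic by blast
qed (use isomorphic_imp_is_PG[OF assms] in blast)

text \<open>The projective case of the interval statement: it is the base of the main induction, and
  it also shows that the common part of the two new pieces is a projective geometry.\<close>

lemma is_PG_ivl:
  fixes M :: "'a matroid" and N :: "'b matroid"
  assumes M: "is_PG TYPE('f::{finite,field}) M" and X: "X \<in> flats M" and Y: "Y \<in> flats M" and XY: "X \<subseteq> Y"
    and N: "matroid N" "simple N" and NM: "isomorphic (flats N) (ivl (flats M) X Y)"
  shows "is_PG TYPE('f) N"
proof -
  obtain k and \<Phi> :: "'a set \<Rightarrow> (nat \<Rightarrow> 'f) set" where \<Phi>: "order_iso \<Phi> (flats M) (subspaces k)"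
    using M is_PG_iff[OF is_PG_imp_matroid[OF M], where 'f = 'f] unfolding isomorphic_def by blast
  have "isomorphic (ivl (flats M) X Y) (ivl (subspaces k) (\<Phi> X) (\<Phi> Y))"
    unfolding isomorphic_def using order_iso_ivl[OF \<Phi> X Y] by blast
  then have 1: "isomorphic (flats N) (ivl (subspaces k) (\<Phi> X) (\<Phi> Y))"
    by (rule isomorphic_trans[OF NM])
  have "\<Phi> X \<subseteq> \<Phi> Y" using order_iso_le[OF \<Phi> X Y] XY by simp
  from subspaces_ivl[OF order_iso_mem[OF \<Phi> X] order_iso_mem[OF \<Phi> Y] this]
  obtain l where "isomorphic (ivl (subspaces k) (\<Phi> X) (\<Phi> Y)) (subspaces l :: (nat \<Rightarrow> 'f) set set)"
    by (elim exE)
  from isomorphic_trans[OF 1 this] show ?thesis by (rule isomorphic_imp_is_PG[OF N])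
qed

lemma PG_modular_in:
  assumes M: "is_PG TYPE('f::{finite,field}) M" and K: "flat M K"
  shows "modular_in (flats M) K"
proof -
  obtain k and \<Phi> :: "'a set \<Rightarrow> (nat \<Rightarrow> 'f) set" where \<Phi>: "order_iso \<Phi> (flats M) (subspaces k)"
    using M is_PG_iff[OF is_PG_imp_matroid[OF M], where 'f = 'f] unfolding isomorphic_def by blast
  have K': "K \<in> flats M" using K by (simp add: flats_def)
  show ?thesis
    by (rule modular_in_order_iso[OF \<Phi> K' modular_in_subspaces[OF order_iso_mem[OF \<Phi> K']]])
qed

text \<open>As for vector spaces: with \<open>a\<close> outside \<open>A\<close> and
  \<open>b\<close> outside \<open>B\<close>, covering puts \<open>a\<close> in \<open>B\<close> and
  \<open>b\<close> in \<open>A\<close>, and then the point of the sum of their vectors lies in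
  neither.\<close>

lemma PG_not_union:
  assumes M: "is_PG TYPE('f::{finite,field}) M" and A: "flat M A" and B: "flat M B" and AB: "A \<union> B = gr M"
  shows "A = gr M \<or> B = gr M"
proof (rule ccontr)
  assume n: "\<not> ?thesis"
  have "A \<subseteq> gr M" "B \<subseteq> gr M" using A B by (simp_all add: flat_def)
  with n have "\<not> gr M \<subseteq> A" "\<not> gr M \<subseteq> B" by auto
  then obtain a b where ab: "a \<in> gr M" "a \<notin> A" "b \<in> gr M" "b \<notin> B" by blast
  obtain k and \<phi> :: "'a \<Rightarrow> (nat \<Rightarrow> 'f) set" where c: "coordinates M k \<phi>"
    using is_PG_coordinates(2)[OF M] by blast
  obtain U where U: "U \<in> subspaces k" "A = {e \<in> gr M. \<phi> e \<subseteq> U}" using coordinates_flatE[OF c A] by blast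
  obtain V where V: "V \<in> subspaces k" "B = {e \<in> gr M. \<phi> e \<subseteq> V}" using coordinates_flatE[OF c B] by blast
  obtain u where u: "u \<in> vecs k" "\<phi> a = line u" using coordinates_vector[OF c ab(1)] by blast
  obtain v where v: "v \<in> vecs k" "\<phi> b = line v" using coordinates_vector[OF c ab(3)] by blast
  have "u \<notin> U" "v \<notin> V" using ab U V u v line_subset[OF U(1)] line_subset[OF V(1)] by auto
  moreover have "a \<in> B" "b \<in> A" using ab unfolding AB[symmetric] by auto
  then have "u \<in> V" "v \<in> U" using U V u v line_subset[OF U(1)] line_subset[OF V(1)] by auto
  ultimately have n: "u + v \<notin> U" "u + v \<notin> V"
    using subspaceD(6)[OF U(1), of "u + v" v] subspaceD(6)[OF V(1), of "u + v" u] by auto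
  then have "u + v \<noteq> 0" using subspaceD(2)[OF U(1)] by auto
  moreover have "u + v \<in> vecs k" by (rule subspaceD(3)[OF vecs_subspace u(1) v(1)])
  ultimately obtain g where g: "g \<in> gr M" "\<phi> g = line (u + v)" using coordinates_line[OF c] by blast
  then have "g \<notin> A" "g \<notin> B" using U V n line_subset[OF U(1)] line_subset[OF V(1)] by auto
  then show False using g(1) unfolding AB[symmetric] by simp
qed

text \<open>The number is q + 1. Only its dependence on the field alone matters later: lines of a
  geometry and of a subgeometry have equal size.\<close>

lemma PG_line_card:
  fixes M :: "'a matroid"
  assumes M: "is_PG TYPE('f::{finite,field}) M" and ab: "a \<in> gr M" "b \<in> gr M" "a \<noteq> b"
  shows "card (cl M {a, b}) = Suc (card (UNIV :: 'f set))"
proof -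
  have mat: "matroid M" by (rule is_PG_imp_matroid[OF M])
  obtain k and \<phi> :: "'a \<Rightarrow> (nat \<Rightarrow> 'f) set" where c: "coordinates M k \<phi>"
    using is_PG_coordinates(2)[OF M] by blast
  obtain u where u: "u \<in> vecs k" "u \<noteq> 0" "\<phi> a = line u" using coordinates_vector[OF c ab(1)] by blast
  obtain v where v: "v \<in> vecs k" "v \<noteq> 0" "\<phi> b = line v" using coordinates_vector[OF c ab(2)] by blast
  have uv: "u \<notin> line v"
    using line_eq[of u v] u v coordinates_inj[OF c ab(1,2)] ab(3) by auto
  define W where "W = subspace_sum (line v) (line u)"
  have W: "W \<in> subspaces k" unfolding W_def by (intro subspace_sum line_subspace u v)
  have uW: "u \<in> W" and vW: "v \<in> W"
    using subspace_sum_left[of "line u" "line v"] subspace_sum_right[of "line v" "line u"]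
      subspaceD(2)[OF line_subspace[OF u(1)]] subspaceD(2)[OF line_subspace[OF v(1)]] line_self[of u] line_self[of v]
    unfolding W_def by auto
  have abgr: "{a, b} \<subseteq> gr M" using ab by auto
  have cl: "cl M {a, b} = {e \<in> gr M. \<phi> e \<subseteq> W}"
  proof
    have "{a, b} \<subseteq> {e \<in> gr M. \<phi> e \<subseteq> W}"
      using ab u v uW vW line_subset[OF W] by auto
    then show "cl M {a, b} \<subseteq> {e \<in> gr M. \<phi> e \<subseteq> W}" by (rule cl_least[OF mat _ coordinates_flat[OF c W]])
    obtain V where V: "V \<in> subspaces k" "cl M {a, b} = {e \<in> gr M. \<phi> e \<subseteq> V}"
      using coordinates_flatE[OF c flat_cl[OF mat abgr]] by blast
    then have "\<phi> a \<subseteq> V" "\<phi> b \<subseteq> V" using subset_cl[OF mat abgr] by auto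
    then have "W \<subseteq> V" unfolding W_def u(3) v(3) using V(1) by (intro subspace_sum_least)
    then show "{e \<in> gr M. \<phi> e \<subseteq> W} \<subseteq> cl M {a, b}" using V(2) by auto
  qed
  \<comment> \<open>The points of the line spanned by \<open>u\<close> and \<open>v\<close>:
    \<open>None\<close> labels the point of \<open>v\<close>, and \<open>Some t\<close> that of
    \<open>u + t v\<close>. The option type accounts for the successor in the count.\<close>
  define \<psi> where "\<psi> = case_option (line v) (\<lambda>t. line (u + smul t v))"
  have nz: "u + smul t v \<noteq> 0" for t
  proof
    assume "u + smul t v = 0"
    then have "u = smul (- t) v" by (simp add: eq_neg_iff_add_eq_0 smul_def fun_eq_iff)
    then show False using uv by (auto simp: line_def)
  qed
  have ratio: "a = 0 \<and> b = 0" if "smul a u = smul b v" for a b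
  proof -
    have "a = 0"
    proof (rule ccontr)
      assume "a \<noteq> 0"
      then have "u = smul (1 / a) (smul a u)" by simp
      also have "\<dots> = smul (b / a) v" using that by simp
      finally show False using uv by (auto simp: line_def)
    qed
    moreover from this that have "smul b v = 0" by simp
    then have "b = 0" using v(2) by (auto simp: smul_def fun_eq_iff)
    ultimately show ?thesis by simp
  qed
  have vt: "v \<notin> line (u + smul t v)" for t
  proof
    assume "v \<in> line (u + smul t v)"
    then obtain s where "v = smul s (u + smul t v)" by (auto simp: line_def)
    then have "smul s u = smul (1 - s * t) v" by (simp add: smul_def fun_eq_iff algebra_simps)
    then show False using ratio by fastforce
  qed
  have tt: "t = t'" if eq: "line (u + smul t v) = line (u + smul t' v)" for t t'
  proof -
    have "u + smul t v \<in> line (u + smul t' v)" using line_self[of "u + smul t v"] unfolding eq .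
    then obtain s where "u + smul t v = smul s (u + smul t' v)" by (auto simp: line_def)
    then have "smul (1 - s) u = smul (s * t' - t) v"
      by (auto simp: smul_def fun_eq_iff algebra_simps)
    then show ?thesis using ratio by fastforce
  qed
  have inj: "inj \<psi>"
  proof (rule injI)
    fix x y assume "\<psi> x = \<psi> y"
    then show "x = y"
      using vt line_self[of v]
      by (cases x; cases y) (auto simp: \<psi>_def dest: tt)
  qed
  have range: "range \<psi> = \<phi> ` cl M {a, b}"
  proof (intro equalityI subsetI)
    fix p assume "p \<in> range \<psi>"
    then obtain w where w: "p = line w" "w \<in> W" "w \<noteq> 0"
    proof -
      obtain x where x: "p = \<psi> x" using \<open>p \<in> range \<psi>\<close> by blast
      have "u + smul t v \<in> W" for t using subspaceD(3,4)[OF W] uW vW by blast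
      then show thesis using that x vW nz v(2) by (cases x) (auto simp: \<psi>_def)
    qed
    have "w \<in> vecs k" using w(2) subspaceD(1)[OF W] by blast
    from coordinates_line[OF c this w(3)] obtain e where e: "e \<in> gr M" "\<phi> e = line w" by blast
    then have "e \<in> cl M {a, b}" unfolding cl using line_subset[OF W] w(2) by simp
    then show "p \<in> \<phi> ` cl M {a, b}" using e(2) w(1) by blast
  next
    fix p assume "p \<in> \<phi> ` cl M {a, b}"
    then obtain e where e: "e \<in> gr M" "\<phi> e \<subseteq> W" "p = \<phi> e" unfolding cl by blast
    obtain w where w: "w \<noteq> 0" "\<phi> e = line w" using coordinates_vector[OF c e(1)] by blast
    then have "w \<in> W" using e(2) line_self by blast
    then obtain s t where st: "w = smul t v + smul s u" unfolding W_def subspace_sum_def line_def by blast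
    show "p \<in> range \<psi>"
    proof (cases "s = 0")
      case True
      then have "w \<in> line v" using st by (auto simp: line_def)
      then have "p = \<psi> None" using line_eq w e(3) by (simp add: \<psi>_def)
      then show ?thesis by blast
    next
      case False
      then have "w = smul s (u + smul (t / s) v)" using st by (simp add: add.commute)
      then have "w \<in> line (u + smul (t / s) v)" unfolding line_def by blast
      then have "p = \<psi> (Some (t / s))" using line_eq w e(3) by (simp add: \<psi>_def)
      then show ?thesis by blast
    qed
  qed
  have "inj_on \<phi> (cl M {a, b})"
    using coordinates_inj[OF c] cl_subset_gr[OF mat] by (intro inj_onI) auto
  then have "card (cl M {a, b}) = card (range \<psi>)" unfolding range by (simp add: card_image)
  also have "\<dots> = card (UNIV :: 'f option set)" by (rule card_image[OF inj])
  also have "\<dots> = Suc (card (UNIV :: 'f set))" by (simp add: UNIV_option_conv card_image)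
  finally show ?thesis .
qed

text \<open>Lines of a geometry over the same finite field have the same number of points, so a
  subgeometry contains the full line through any two of its points.\<close>
lemma PG_subgeometry_flat:
  fixes M :: "'a matroid"
  assumes M: "is_PG TYPE('f::{finite,field}) M" and K: "K \<subseteq> gr M"
    and MK: "is_PG TYPE('f) (restr M K)"
  shows "flat M K"
proof -
  have mat: "matroid M" by (rule is_PG_imp_matroid[OF M])
  have closed: "cl M {a, b} \<subseteq> K" if ab: "a \<in> K" "b \<in> K" "a \<noteq> b" for a b
  proof -
    have "cl (restr M K) {a, b} = cl M {a, b} \<inter> K" using ab K by (intro cl_restr) auto
    \<comment> \<open>The line through \<open>a\<close> and \<open>b\<close> in the restriction is a
      part of their line in \<open>M\<close>, and both have q + 1 points.\<close>
    then have "card (cl M {a, b} \<inter> K) = card (cl M {a, b})"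
      using PG_line_card[OF M, of a b] PG_line_card[OF MK, of a b] ab subsetD[OF K] by simp
    moreover have "finite (cl M {a, b})" by (rule finite_subset[OF cl_subset_gr[OF mat] finite_gr[OF mat]])
    ultimately have "cl M {a, b} \<inter> K = cl M {a, b}" by (simp add: card_subset_eq)
    then show ?thesis by auto
  qed
  obtain k and \<phi> :: "'a \<Rightarrow> (nat \<Rightarrow> 'f) set" where c: "coordinates M k \<phi>"
    using is_PG_coordinates(2)[OF M] by blast
  let ?U = "insert 0 (\<Union>(\<phi> ` K))"
  have sub: "\<phi> e \<in> subspaces k" if "e \<in> K" for e
    using coordinates_subspace[OF c] that K by auto
  have add: "u + v \<in> ?U" if u: "u \<in> \<phi> e" "e \<in> K" and v: "v \<in> \<phi> f" "f \<in> K" for u v e f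
  proof (cases "e = f")
    case True
    then have "u + v \<in> \<phi> e" using subspaceD(3)[OF sub[OF u(2)] u(1)] v(1) by simp
    then show ?thesis using u(2) by auto
  next
    case False
    have ef: "{e, f} \<subseteq> gr M" using u v K by auto
    obtain V where V: "V \<in> subspaces k" "cl M {e, f} = {e \<in> gr M. \<phi> e \<subseteq> V}"
      using coordinates_flatE[OF c flat_cl[OF mat ef]] by blast
    then have "\<phi> e \<subseteq> V" "\<phi> f \<subseteq> V" using subset_cl[OF mat ef] by auto
    \<comment> \<open>The point of \<open>u + v\<close> lies on the line through \<open>e\<close>
      and \<open>f\<close>, which is contained in \<open>K\<close>. Hence the vectors of the points
      of \<open>K\<close> form a subspace.\<close>
    then have uv: "u + v \<in> V" using subspaceD(3)[OF V(1)] u v by blast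
    show ?thesis
    proof (cases "u + v = 0")
      case nz: False
      have "u + v \<in> vecs k" using uv subspaceD(1)[OF V(1)] by blast
      from coordinates_line[OF c this nz] obtain g where g: "g \<in> gr M" "\<phi> g = line (u + v)" by blast
      then have "g \<in> cl M {e, f}" using V uv line_subset[OF V(1)] by simp
      then have "g \<in> K" using closed[OF u(2) v(2) False] by blast
      then show ?thesis using g(2) line_self by auto
    qed simp
  qed
  have U: "?U \<in> subspaces k"
    unfolding subspaces_def mem_Collect_eq
  proof (intro conjI ballI allI)
    show "?U \<subseteq> vecs k"
      using subspaceD(1)[OF sub] subspaceD(2)[OF vecs_subspace] by auto
    fix u assume u: "u \<in> ?U"
    show "smul a u \<in> ?U" for a using u subspaceD(4)[OF sub] by auto
    fix v assume v: "v \<in> ?U"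
    show "u + v \<in> ?U"
    proof (cases "u = 0 \<or> v = 0")
      case False
      then show ?thesis using u v add by blast
    qed (use u v in auto)
  qed simp
  have "e \<in> K" if e: "e \<in> gr M" "\<phi> e \<subseteq> ?U" for e
  proof -
    obtain v where v: "v \<noteq> 0" "\<phi> e = line v" using coordinates_vector[OF c e(1)] by blast
    then have "v \<in> ?U" using e(2) line_self by blast
    then obtain f where f: "f \<in> K" "v \<in> \<phi> f" using v(1) by blast
    then have "\<phi> f = \<phi> e" using PG_point_line[OF coordinates_point[OF c] _ v(1), of f] K v(2) by auto
    then show "e \<in> K" using coordinates_inj[OF c, of f e] f(1) K e(1) by auto
  qed
  then have "K = {e \<in> gr M. \<phi> e \<subseteq> ?U}" using K by auto
  then show ?thesis using coordinates_flat[OF c U] by simp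
qed

section \<open>Amalgams along a common modular flat\<close>

lemma order_iso_Int:
  assumes "order_iso \<Phi> L K" "A \<in> L" "B \<in> L" "A \<inter> B \<in> L" "\<Phi> A \<inter> \<Phi> B \<in> K"
  shows "\<Phi> (A \<inter> B) = \<Phi> A \<inter> \<Phi> B"
proof -
  note le = order_iso_le[OF assms(1)]
  obtain C where C: "C \<in> L" "\<Phi> C = \<Phi> A \<inter> \<Phi> B" using order_iso_surj[OF assms(1,5)] by blast
  have "C \<subseteq> A \<inter> B" using le[OF C(1) assms(2)] le[OF C(1) assms(3)] C(2) by simp
  then have "\<Phi> A \<inter> \<Phi> B \<subseteq> \<Phi> (A \<inter> B)" using le[OF C(1) assms(4)] C(2) by simp
  moreover have "\<Phi> (A \<inter> B) \<subseteq> \<Phi> A" "\<Phi> (A \<inter> B) \<subseteq> \<Phi> B"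
    using le[OF assms(4,2)] le[OF assms(4,3)] by simp_all
  ultimately show ?thesis by blast
qed

text \<open>Above \<open>X\<close> and below \<open>X \<or> (Y \<and> E)\<close>, a flat is
  determined by its trace on \<open>E\<close>; later, such flats are compared by looking at one part
  of the amalgam only.\<close>

lemma modular_generated:
  assumes M: "matroid M" and mod: "modular_in (flats M) E" and X: "flat M X"
    and C: "flat M C" "X \<subseteq> C" "C \<subseteq> cl M (X \<union> (Y \<inter> E))"
  shows "C = cl M (X \<union> (C \<inter> E))"
proof -
  have "cl M (X \<union> (Y \<inter> E)) \<subseteq> cl M (E \<union> X)" by (rule cl_mono[OF M]) auto
  then have "C \<inter> cl M (E \<union> X) = C" using C(3) by auto
  then show ?thesis using modular_law_above[OF M mod X C(1,2)] by simp
qed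

lemma restr_ivl_order_iso:
  assumes N: "matroid N" "simple N" and \<Phi>: "order_iso \<Phi> (flats N) (ivl (flats M) X Y)"
    and XY: "flat M X" "flat M Y" "X \<subseteq> Y" and Z: "flat N Z"
  shows "order_iso \<Phi> (flats (restr N Z)) (ivl (flats M) X (\<Phi> Z))" and "\<Phi> {} = X"
proof -
  have e: "{} \<in> flats N" using N(2) simple_iff_flats[OF N(1)] by (simp add: flats_def)
  have Z': "Z \<in> flats N" using Z by (simp add: flats_def)
  have "X \<in> ivl (flats M) X Y" using XY by (simp add: ivl_def flats_def)
  then obtain A where A: "A \<in> flats N" "\<Phi> A = X" using order_iso_surj[OF \<Phi>] by blast
  have "\<Phi> {} \<subseteq> X" using order_iso_le[OF \<Phi> e A(1)] A(2) by simp
  moreover have "X \<subseteq> \<Phi> {}" using order_iso_mem[OF \<Phi> e] by (simp add: ivl_def)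
  ultimately show e0: "\<Phi> {} = X" by simp
  have ZY: "\<Phi> Z \<subseteq> Y" using order_iso_mem[OF \<Phi> Z'] by (simp add: ivl_def)
  show "order_iso \<Phi> (flats (restr N Z)) (ivl (flats M) X (\<Phi> Z))"
    using order_iso_ivl[OF \<Phi> e Z'] ivl_ivl[OF subset_refl ZY, where X = X and L = "flats M"]
    unfolding e0 flats_restr_flat[OF N(1) Z] by simp
qed

text \<open>This combines the given isomorphism with the diamond isomorphism, turning a piece of
  \<open>N\<close> into an interval below the modular flat \<open>E\<close>, where an induction
  hypothesis can be used.\<close>

lemma restr_ivl_isomorphic:
  assumes N: "matroid N" "simple N" and \<Phi>: "order_iso \<Phi> (flats N) (ivl (flats M) X Y)"
    and M: "matroid M" and mod: "modular_in (flats M) E"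
    and XY: "flat M X" "flat M Y" "X \<subseteq> Y" and Z: "flat N Z" "\<Phi> Z = cl M (X \<union> (Y \<inter> E))"
  shows "isomorphic (flats (restr N Z)) (ivl (flats M) (X \<inter> E) (Y \<inter> E))"
proof -
  have "isomorphic (flats (restr N Z)) (ivl (flats M) X (cl M (X \<union> (Y \<inter> E))))"
    using restr_ivl_order_iso(1)[OF N \<Phi> XY Z(1)] unfolding Z(2) isomorphic_def by blast
  moreover have "isomorphic (ivl (flats M) X (cl M (X \<union> (Y \<inter> E)))) (ivl (flats M) (X \<inter> E) (Y \<inter> E))"
    using modular_ivl_iso[OF M mod XY] unfolding isomorphic_def by blast
  ultimately show ?thesis by (rule isomorphic_trans)
qed

text \<open>A form of the parallel connection symmetric in the two parts, with the common flat
  modular in both. Facts about the first part pass to the second by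
  \<open>amalgam_swap\<close>.\<close>

locale amalgam =
  fixes P M1 M2 :: "'a matroid"
  assumes P: "matroid P" and M1: "matroid M1" and M2: "matroid M2"
    and gr_P: "gr P = gr M1 \<union> gr M2"
    and flat_P: "flat P X \<longleftrightarrow> X \<subseteq> gr P \<and> flat M1 (X \<inter> gr M1) \<and> flat M2 (X \<inter> gr M2)"
    and mod1: "modular_in (flats M1) (gr M1 \<inter> gr M2)"
    and mod2: "modular_in (flats M2) (gr M1 \<inter> gr M2)"
    and restr_eq: "restr M1 (gr M1 \<inter> gr M2) = restr M2 (gr M1 \<inter> gr M2)"

lemma amalgam_swap: "amalgam P M1 M2 \<Longrightarrow> amalgam P M2 M1"
proof -
  assume "amalgam P M1 M2"
  then interpret amalgam P M1 M2 .
  have "gr M2 \<inter> gr M1 = gr M1 \<inter> gr M2" "gr P = gr M2 \<union> gr M1" using gr_P by auto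
  then show ?thesis
    using P M1 M2 mod1 mod2 restr_eq flat_P by unfold_locales auto
qed

context amalgam
begin

lemma flat_T: "flat M1 (gr M1 \<inter> gr M2)" "flat M2 (gr M1 \<inter> gr M2)"
  using mod1 mod2 by (auto simp: modular_in_def flats_def)

lemma flat_below_T: "F \<subseteq> gr M1 \<inter> gr M2 \<Longrightarrow> flat M1 F \<longleftrightarrow> flat M2 F"
proof -
  assume F: "F \<subseteq> gr M1 \<inter> gr M2"
  have "ivl (flats M1) {} (gr M1 \<inter> gr M2) = ivl (flats M2) {} (gr M1 \<inter> gr M2)"
    using flats_restr_flat[OF M1 flat_T(1)] flats_restr_flat[OF M2 flat_T(2)] restr_eq by simp
  then have "F \<in> ivl (flats M1) {} (gr M1 \<inter> gr M2) \<longleftrightarrow> F \<in> ivl (flats M2) {} (gr M1 \<inter> gr M2)"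
    by (rule arg_cong)
  then show ?thesis using F by (simp add: ivl_def flats_def)
qed

text \<open>The trace of a flat of \<open>M1\<close> on the second part lies in the common flat,
  below which both matroids have the same flats; so it is a flat of \<open>P\<close> as
  well.\<close>

lemma flats_M1: "flats M1 = ivl (flats P) {} (gr M1)"
proof (intro equalityI subsetI)
  fix F assume "F \<in> flats M1"
  then have F: "flat M1 F" "F \<subseteq> gr M1" by (auto simp: flats_def flat_def)
  have "F \<inter> gr M1 = F" "F \<inter> (gr M1 \<inter> gr M2) = F \<inter> gr M2" using F(2) by auto
  then have "flat M2 (F \<inter> gr M2)"
    using flat_below_T[of "F \<inter> gr M2"] flat_Int[OF M1 F(1) flat_T(1)] F(2) by auto
  then have "flat P F" unfolding flat_P using F \<open>F \<inter> gr M1 = F\<close> gr_P by auto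
  then show "F \<in> ivl (flats P) {} (gr M1)" using F(2) by (simp add: ivl_def flats_def)
next
  fix F assume "F \<in> ivl (flats P) {} (gr M1)"
  then have "flat P F" "F \<subseteq> gr M1" by (auto simp: ivl_def flats_def)
  then show "F \<in> flats M1" unfolding flat_P by (simp add: flats_def Int_absorb2)
qed

lemma flat_Int_gr: "flat P F \<Longrightarrow> flat M1 (F \<inter> gr M1)" "flat P F \<Longrightarrow> flat M2 (F \<inter> gr M2)"
  by (simp_all add: flat_P)

text \<open>Adding the ground set of \<open>M1\<close> to \<open>F\<close> affects the second part
  only by \<open>C\<close>, the join of the common flat with \<open>F \<inter> gr M2\<close>,
  because \<open>gr M1 \<union> C\<close> is a flat of \<open>P\<close>. Modularity of the common
  flat in \<open>M2\<close> then decides equality on the second part, and the meet condition decides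
  it on the first.\<close>

lemma modular_gr_M1: "modular_in (flats P) (gr M1)"
proof (rule modular_inI[OF P])
  let ?T = "gr M1 \<inter> gr M2"
  have "flat M1 (gr M1)" by (rule flat_gr[OF M1])
  then show "flat P (gr M1)" using flats_M1 by (auto simp: ivl_def flats_def)
  fix F F' assume F: "flat P F" "flat P F'" "F \<subseteq> F'"
    and j: "F' \<subseteq> cl P (gr M1 \<union> F)" and m: "gr M1 \<inter> F' \<subseteq> F"
  have Fgr: "F \<subseteq> gr P" "F' \<subseteq> gr P" using F by (auto simp: flat_def)
  have gr2: "?T \<union> (F \<inter> gr M2) \<subseteq> gr M2" by auto
  define C where "C = cl M2 (?T \<union> (F \<inter> gr M2))"
  have C: "flat M2 C" "?T \<union> (F \<inter> gr M2) \<subseteq> C" "C \<subseteq> gr M2"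
    unfolding C_def using flat_cl[OF M2 gr2] subset_cl[OF M2 gr2] cl_subset_gr[OF M2] by auto
  have "(gr M1 \<union> C) \<inter> gr M1 = gr M1" "(gr M1 \<union> C) \<inter> gr M2 = C" using C by auto
  then have "flat P (gr M1 \<union> C)" unfolding flat_P using flat_gr[OF M1] C gr_P by auto
  moreover have "gr M1 \<union> F \<subseteq> gr M1 \<union> C" using C(2) Fgr gr_P by auto
  ultimately have "F' \<subseteq> gr M1 \<union> C" using j cl_least[OF P] by blast
  then have "F' \<inter> gr M2 \<subseteq> C" using C(2) by auto
  then have "F \<inter> gr M2 = F' \<inter> gr M2"
    using F m unfolding C_def
    by (intro modular_inD[OF M2 mod2 flat_Int_gr(2)[OF F(1)] flat_Int_gr(2)[OF F(2)]]) auto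
  then show "F = F'" using F(3) m Fgr gr_P by auto
qed

lemma modular_T: "modular_in (flats P) (gr M1 \<inter> gr M2)"
  by (rule modular_in_trans[OF P modular_gr_M1]) (use mod1 flats_M1 in simp)

lemma modular_gr_M2: "modular_in (flats P) (gr M2)"
  using amalgam.modular_gr_M1[OF amalgam_swap] amalgam_axioms by blast

lemma flats_M2: "flats M2 = ivl (flats P) {} (gr M2)"
  using amalgam.flats_M1[OF amalgam_swap] amalgam_axioms by blast

text \<open>The lattice of flats of an interval \<open>[X, Y]\<close> of an amalgam is glued in the same way from
  the intervals \<open>[X, X \<or> (Y \<and> E)]\<close>, where \<open>E\<close> is the ground set of one of the two parts.\<close>
lemma meet_parts:
  assumes X: "flat P X" and Y: "flat P Y" and XY: "X \<subseteq> Y"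
  shows "cl P (X \<union> (Y \<inter> gr M1)) \<inter> cl P (X \<union> (Y \<inter> gr M2)) = cl P (X \<union> (Y \<inter> (gr M1 \<inter> gr M2)))"
    (is "?H1 \<inter> ?H2 = ?J")
proof
  have gr: "X \<subseteq> gr P" "Y \<subseteq> gr P" using X Y by (auto simp: flat_def)
  have gr1: "X \<union> (Y \<inter> gr M1) \<subseteq> gr P" and gr2: "X \<union> (Y \<inter> gr M2) \<subseteq> gr P"
    and gr3: "X \<union> (Y \<inter> (gr M1 \<inter> gr M2)) \<subseteq> gr P" using gr by auto
  show "?J \<subseteq> ?H1 \<inter> ?H2" by (intro Int_greatest cl_mono[OF P]) auto
  have J: "flat P ?J" by (rule flat_cl[OF P gr3])
  have JX: "X \<union> (Y \<inter> (gr M1 \<inter> gr M2)) \<subseteq> ?J" by (rule subset_cl[OF P gr3])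
  have JY: "?J \<subseteq> Y" using XY by (intro cl_least[OF P _ Y]) auto
  \<comment> \<open>\<open>B\<close> has the trace of \<open>?J\<close> on the first part and that
    of \<open>Y\<close> on the second. These agree on the common flat, so \<open>B\<close> is a flat
    of \<open>P\<close> and bounds \<open>?H2\<close>; thus \<open>?H2\<close> meets the first part
    within \<open>?J\<close>. The modular law extends this to the intersection with
    \<open>?H1\<close>.\<close>
  define B where "B = (?J \<inter> gr M1) \<union> (Y \<inter> gr M2)"
  have B: "B \<inter> gr M1 = ?J \<inter> gr M1" "B \<inter> gr M2 = Y \<inter> gr M2" unfolding B_def using JX JY by auto
  have "flat P B"
    unfolding flat_P B using flat_Int_gr[OF J] flat_Int_gr[OF Y] gr_P by (auto simp: B_def)
  moreover have "X \<union> (Y \<inter> gr M2) \<subseteq> B" unfolding B_def using XY JX gr gr_P by auto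
  ultimately have "?H2 \<subseteq> B" by (intro cl_least[OF P])
  then have "?H2 \<inter> gr M1 \<subseteq> ?J" using B(1) by auto
  then have "cl P (X \<union> (?H2 \<inter> gr M1)) \<subseteq> ?J" using JX by (intro cl_least[OF P _ J]) auto
  moreover have "?H2 \<inter> cl P (gr M1 \<union> X) = cl P (X \<union> (?H2 \<inter> gr M1))"
    using subset_cl[OF P gr2] by (intro modular_law_above[OF P modular_gr_M1 X flat_cl[OF P gr2]]) auto
  moreover have "?H1 \<subseteq> cl P (gr M1 \<union> X)" by (rule cl_mono[OF P]) auto
  ultimately show "?H1 \<inter> ?H2 \<subseteq> ?J" by auto
qed

context
  fixes N :: "'b matroid" and \<Phi> :: "'b set \<Rightarrow> 'a set" and X Y :: "'a set" and Z1 Z2 :: "'b set"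
  assumes N: "matroid N" "simple N" and \<Phi>: "order_iso \<Phi> (flats N) (ivl (flats P) X Y)"
    and X: "flat P X" and Y: "flat P Y" and XY: "X \<subseteq> Y"
    and Z1: "flat N Z1" "\<Phi> Z1 = cl P (X \<union> (Y \<inter> gr M1))"
    and Z2: "flat N Z2" "\<Phi> Z2 = cl P (X \<union> (Y \<inter> gr M2))"
begin

private lemma image_flat: "flat N Z \<Longrightarrow> flat P (\<Phi> Z) \<and> X \<subseteq> \<Phi> Z \<and> \<Phi> Z \<subseteq> Y"
  using order_iso_mem[OF \<Phi>, of Z] by (simp add: flats_def ivl_def)

private lemma image_le: "flat N A \<Longrightarrow> flat N B \<Longrightarrow> \<Phi> A \<subseteq> \<Phi> B \<longleftrightarrow> A \<subseteq> B"
  using order_iso_le[OF \<Phi>, of A B] by (simp add: flats_def)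

private lemma image_Int: "flat N A \<Longrightarrow> flat N B \<Longrightarrow> \<Phi> (A \<inter> B) = \<Phi> A \<inter> \<Phi> B"
  using order_iso_Int[OF \<Phi>, of A B] image_flat[of A] image_flat[of B] flat_Int[OF N(1), of A B] flat_Int[OF P, of "\<Phi> A" "\<Phi> B"]
  by (auto simp: flats_def ivl_def)

private lemma parts_subset: "X \<union> (Y \<inter> gr M1) \<subseteq> \<Phi> Z1" "X \<union> (Y \<inter> gr M2) \<subseteq> \<Phi> Z2"
proof -
  have "X \<subseteq> gr P" "Y \<subseteq> gr P" using X Y by (auto simp: flat_def)
  then show "X \<union> (Y \<inter> gr M1) \<subseteq> \<Phi> Z1" "X \<union> (Y \<inter> gr M2) \<subseteq> \<Phi> Z2"
    unfolding Z1(2) Z2(2) by (intro subset_cl[OF P]; auto)+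
qed

text \<open>The flat \<open>\<Phi> {z}\<close> properly contains \<open>X = \<Phi> {}\<close>. An
  element of it outside \<open>X\<close> lies in one of the two parts, hence in
  \<open>\<Phi> Z1\<close> or \<open>\<Phi> Z2\<close>, and this excludes that \<open>z\<close>
  misses both \<open>Z1\<close> and \<open>Z2\<close>.\<close>

lemma ivl_ground: "gr N = Z1 \<union> Z2"
proof (intro equalityI subsetI)
  fix z assume z: "z \<in> gr N"
  then have zf: "flat N {z}" and ef: "flat N {}" using N(2) simple_iff_flats[OF N(1)] by auto
  have e0: "\<Phi> {} = X" by (rule restr_ivl_order_iso(2)[OF N \<Phi> X Y XY zf])
  have "\<not> \<Phi> {z} \<subseteq> \<Phi> {}" using image_le[OF zf ef] by simp
  then obtain p where p: "p \<in> \<Phi> {z}" "p \<notin> X" unfolding e0 by blast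
  then have "p \<in> Y" "p \<in> gr M1 \<union> gr M2" using image_flat[OF zf] gr_P by (auto simp: flat_def)
  then have "p \<in> \<Phi> {z} \<inter> \<Phi> Z1 \<or> p \<in> \<Phi> {z} \<inter> \<Phi> Z2" using p(1) parts_subset by auto
  then have "p \<in> \<Phi> ({z} \<inter> Z1) \<or> p \<in> \<Phi> ({z} \<inter> Z2)" using image_Int[OF zf Z1(1)] image_Int[OF zf Z2(1)] by simp
  moreover have "p \<notin> \<Phi> A" if "A = {}" for A using p(2) e0 that by simp
  ultimately have "{z} \<inter> Z1 \<noteq> {} \<or> {z} \<inter> Z2 \<noteq> {}" by metis
  then show "z \<in> Z1 \<union> Z2" by auto
qed (use Z1 Z2 in \<open>auto simp: flat_def\<close>)

lemma ivl_meet: "\<Phi> (Z1 \<inter> Z2) = cl P (X \<union> (Y \<inter> (gr M1 \<inter> gr M2)))"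
  using image_Int[OF Z1(1) Z2(1)] meet_parts[OF X Y XY] Z1(2) Z2(2) by simp

text \<open>The common flat of the amalgam is modular in \<open>P\<close>, so it induces a modular
  element of the interval from \<open>X\<close> to \<open>\<Phi> Z1\<close>; this element is
  \<open>\<Phi> (Z1 \<inter> Z2)\<close>, and \<open>\<Phi>\<close> pulls modularity back.\<close>

lemma ivl_modular: "modular_in (flats (restr N Z1)) (Z1 \<inter> Z2)"
proof (rule modular_in_order_iso[OF restr_ivl_order_iso(1)[OF N \<Phi> X Y XY Z1(1)]])
  show "Z1 \<inter> Z2 \<in> flats (restr N Z1)"
    unfolding flats_restr_flat[OF N(1) Z1(1)] using flat_Int[OF N(1) Z1(1) Z2(1)]
    by (simp add: ivl_def flats_def)
  have "\<Phi> Z1 \<inter> (gr M1 \<inter> gr M2) = Y \<inter> (gr M1 \<inter> gr M2)"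
    using parts_subset image_flat[OF Z1(1)] by auto
  then show "modular_in (ivl (flats P) X (\<Phi> Z1)) (\<Phi> (Z1 \<inter> Z2))"
    using modular_in_ivl[OF P modular_T X, of "\<Phi> Z1"] image_flat[OF Z1(1)] ivl_meet by simp
qed

text \<open>The gluing property of \<open>N\<close>. The images of the two traces of
  \<open>Z\<close> are glued to a flat of \<open>P\<close> in the interval, and its preimage under
  \<open>\<Phi>\<close> has the same traces as \<open>Z\<close>, hence is \<open>Z\<close>.\<close>

lemma ivl_flat_iff:
  assumes Z: "Z \<subseteq> gr N"
  shows "flat N Z \<longleftrightarrow> flat N (Z \<inter> Z1) \<and> flat N (Z \<inter> Z2)"
proof
  assume "flat N Z"
  then show "flat N (Z \<inter> Z1) \<and> flat N (Z \<inter> Z2)" using flat_Int[OF N(1)] Z1 Z2 by simp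
next
  assume *: "flat N (Z \<inter> Z1) \<and> flat N (Z \<inter> Z2)"
  then have f1: "flat N (Z \<inter> Z1)" and f2: "flat N (Z \<inter> Z2)" by auto
  define A1 where "A1 = \<Phi> (Z \<inter> Z1)"
  define A2 where "A2 = \<Phi> (Z \<inter> Z2)"
  have A1: "flat P A1" "X \<subseteq> A1" "A1 \<subseteq> Y" and A2: "flat P A2" "X \<subseteq> A2" "A2 \<subseteq> Y"
    unfolding A1_def A2_def using image_flat[OF f1] image_flat[OF f2] by auto
  have AH: "A1 \<subseteq> \<Phi> Z1" "A2 \<subseteq> \<Phi> Z2"
    unfolding A1_def A2_def using image_le[OF f1 Z1(1)] image_le[OF f2 Z2(1)] by auto
  \<comment> \<open>Both sides are the image of \<open>Z \<inter> Z1 \<inter> Z2\<close>. Since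
    \<open>Y\<close> meets the common flat of the amalgam inside \<open>\<Phi> Z1\<close> and
    \<open>\<Phi> Z2\<close>, the flats \<open>A1\<close> and \<open>A2\<close> agree there and can
    be glued.\<close>
  have "A1 \<inter> \<Phi> Z2 = A2 \<inter> \<Phi> Z1"
  proof -
    have "Z \<inter> Z1 \<inter> Z2 = Z \<inter> Z2 \<inter> Z1" by auto
    then show ?thesis unfolding A1_def A2_def using image_Int[OF f1 Z2(1)] image_Int[OF f2 Z1(1)] by simp
  qed
  then have T: "A1 \<inter> (gr M1 \<inter> gr M2) = A2 \<inter> (gr M1 \<inter> gr M2)"
    using parts_subset A1(3) A2(3) by blast
  define B where "B = (A1 \<inter> gr M1) \<union> (A2 \<inter> gr M2)"
  have B: "B \<inter> gr M1 = A1 \<inter> gr M1" "B \<inter> gr M2 = A2 \<inter> gr M2" unfolding B_def using T by auto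
  have Bf: "flat P B"
    unfolding flat_P B using flat_Int_gr[OF A1(1)] flat_Int_gr[OF A2(1)] gr_P by (auto simp: B_def)
  have XB: "X \<subseteq> B" using A1(2) A2(2) X gr_P unfolding B_def flat_def by auto
  have BY: "B \<subseteq> Y" unfolding B_def using A1(3) A2(3) by auto
  have gen1: "C = cl P (X \<union> (C \<inter> gr M1))" if "flat P C" "X \<subseteq> C" "C \<subseteq> \<Phi> Z1" for C
    using modular_generated[OF P modular_gr_M1 X that(1,2), of Y] that(3) Z1(2) by simp
  have gen2: "C = cl P (X \<union> (C \<inter> gr M2))" if "flat P C" "X \<subseteq> C" "C \<subseteq> \<Phi> Z2" for C
    using modular_generated[OF P modular_gr_M2 X that(1,2), of Y] that(3) Z2(2) by simp
  have "A1 \<subseteq> B"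
    by (subst gen1[OF A1(1,2) AH(1)], rule cl_least[OF P _ Bf]) (use XB B(1) in auto)
  moreover have "A2 \<subseteq> B"
    by (subst gen2[OF A2(1,2) AH(2)], rule cl_least[OF P _ Bf]) (use XB B(2) in auto)
  moreover obtain Z' where Z': "flat N Z'" "\<Phi> Z' = B"
  proof -
    have "B \<in> ivl (flats P) X Y" using Bf XB BY by (simp add: ivl_def flats_def)
    from order_iso_surj[OF \<Phi> this] show thesis using that by (auto simp: flats_def)
  qed
  ultimately have "Z \<inter> Z1 \<subseteq> Z'" "Z \<inter> Z2 \<subseteq> Z'"
    using image_le[OF f1 Z'(1)] image_le[OF f2 Z'(1)] unfolding A1_def A2_def by auto
  \<comment> \<open>The image of the left side is generated by \<open>X\<close> and its trace on the
    first part, and on that part \<open>B\<close> coincides with \<open>A1\<close>.\<close>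
  moreover have "Z' \<inter> Z1 \<subseteq> Z \<inter> Z1"
  proof -
    have f: "flat N (Z' \<inter> Z1)" by (rule flat_Int[OF N(1) Z'(1) Z1(1)])
    have e: "\<Phi> (Z' \<inter> Z1) = B \<inter> \<Phi> Z1" using image_Int[OF Z'(1) Z1(1)] Z'(2) by simp
    have "\<Phi> (Z' \<inter> Z1) = cl P (X \<union> (\<Phi> (Z' \<inter> Z1) \<inter> gr M1))"
      using gen1[of "\<Phi> (Z' \<inter> Z1)"] image_flat[OF f] e by simp
    also have "\<dots> \<subseteq> A1"
      using A1(2) B(1) unfolding e by (intro cl_least[OF P _ A1(1)]) auto
    finally show ?thesis using image_le[OF f f1] unfolding A1_def by simp
  qed
  moreover have "Z' \<inter> Z2 \<subseteq> Z \<inter> Z2"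
  proof -
    have f: "flat N (Z' \<inter> Z2)" by (rule flat_Int[OF N(1) Z'(1) Z2(1)])
    have e: "\<Phi> (Z' \<inter> Z2) = B \<inter> \<Phi> Z2" using image_Int[OF Z'(1) Z2(1)] Z'(2) by simp
    have "\<Phi> (Z' \<inter> Z2) = cl P (X \<union> (\<Phi> (Z' \<inter> Z2) \<inter> gr M2))"
      using gen2[of "\<Phi> (Z' \<inter> Z2)"] image_flat[OF f] e by simp
    also have "\<dots> \<subseteq> A2"
      using A2(2) B(2) unfolding e by (intro cl_least[OF P _ A2(1)]) auto
    finally show ?thesis using image_le[OF f f2] unfolding A2_def by simp
  qed
  moreover have "Z' \<subseteq> Z1 \<union> Z2" "Z \<subseteq> Z1 \<union> Z2"
    using Z'(1) Z ivl_ground by (auto simp: flat_def)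
  ultimately have "Z = Z'" by blast
  then show "flat N Z" using Z'(1) by simp
qed

end

end

section \<open>Chordal matroids\<close>

lemma is_gpcD:
  assumes "is_gpc F P M1 M2"
  shows "matroid M1" "matroid M2" "simple M1" "simple M2" "matroid P" "gr P = gr M1 \<union> gr M2"
    "restr M1 (gr M1 \<inter> gr M2) = restr M2 (gr M1 \<inter> gr M2)" "is_PG F (restr M1 (gr M1 \<inter> gr M2))"
    "flat P X \<longleftrightarrow> X \<subseteq> gr P \<and> flat M1 (X \<inter> gr M1) \<and> flat M2 (X \<inter> gr M2)"
  using assms unfolding is_gpc_def Let_def by auto

lemma gpc_simple:
  assumes gpc: "is_gpc F P M1 M2"
  shows "simple P"
proof -
  note g = is_gpcD[OF gpc]
  have s: "flat M1 {}" "flat M2 {}" "e \<in> gr M1 \<Longrightarrow> flat M1 {e}" "e \<in> gr M2 \<Longrightarrow> flat M2 {e}" for e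
    using g(3,4) simple_iff_flats[OF g(1)] simple_iff_flats[OF g(2)] by auto
  have "flat P {e}" if "e \<in> gr P" for e
    unfolding g(9) using that s(1,2) s(3,4)[of e] by (cases "e \<in> gr M1"; cases "e \<in> gr M2") auto
  then show ?thesis
    unfolding simple_iff_flats[OF g(5)] using s g(9)[of "{}"] by auto
qed

lemma chordal_matroid_simple:
  "chordal TYPE('f::{finite,field}) M \<Longrightarrow> matroid M \<and> simple M"
proof (induction rule: chordal.induct)
  case (base M)
  then show ?case using is_PG_imp_matroid is_PG_coordinates(1) by blast
next
  case (gpc M1 M2 P)
  then show ?case using gpc_simple is_gpcD(5) by blast
qed

lemma is_PG_flats_cong:
  fixes M N :: "'a matroid"
  assumes "is_PG TYPE('f::{finite,field}) M" "matroid N" "simple N" "flats N = flats M"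
  shows "is_PG TYPE('f) N"
  using assms(1) is_PG_iff[OF is_PG_imp_matroid[OF assms(1)], where 'f = 'f]
    is_PG_iff[OF assms(2), where 'f = 'f] assms(3,4) by simp

text \<open>The amalgam is described by its flats, so \<open>P\<close> and \<open>M1\<close> are
  compared on \<open>K\<close> by their traces of flats, and these coincide. This makes
  \<open>K\<close> projective in \<open>M1\<close>; modularity then passes from \<open>M1\<close> to
  \<open>P\<close> by transitivity.\<close>

lemma (in amalgam) PG_restr_modular:
  assumes K: "K \<subseteq> gr M1" and PG: "is_PG TYPE('f::{finite,field}) (restr P K)" and s: "simple M1"
    and IH: "is_PG TYPE('f) (restr M1 K) \<Longrightarrow> modular_in (flats M1) K"
  shows "modular_in (flats P) K"
proof -
  have KP: "K \<subseteq> gr P" using K gr_P by auto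
  have "flats (restr M1 K) = flats (restr P K)"
    unfolding flats_restr[OF M1 K] flats_restr[OF P KP]
  proof (intro equalityI image_subsetI)
    fix F assume "F \<in> flats M1"
    then have "F \<in> flats P" unfolding flats_M1 by (simp add: ivl_def)
    then show "F \<inter> K \<in> (\<lambda>F. F \<inter> K) ` flats P" by blast
  next
    fix F assume "F \<in> flats P"
    then have "F \<inter> gr M1 \<in> flats M1" using flat_Int_gr(1) by (simp add: flats_def)
    moreover have "F \<inter> K = (F \<inter> gr M1) \<inter> K" using K by auto
    ultimately show "F \<inter> K \<in> (\<lambda>F. F \<inter> K) ` flats M1" by blast
  qed
  then have "is_PG TYPE('f) (restr M1 K)"
    by (rule is_PG_flats_cong[OF PG matroid_restr[OF M1 K] simple_restr[OF s K]])
  then have "modular_in (ivl (flats P) {} (gr M1)) K" using IH flats_M1 by simp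
  then show ?thesis by (rule modular_in_trans[OF P modular_gr_M1])
qed

text \<open>By definition the common part of a generalized parallel connection is a modular flat of the
  first matroid only; being a projective geometry, it is one of the second matroid as well.\<close>
lemma chordal_PG_modular:
  "chordal TYPE('f::{finite,field}) M \<Longrightarrow> K \<subseteq> gr M \<Longrightarrow> is_PG TYPE('f) (restr M K) \<Longrightarrow>
    modular_in (flats M) K"
proof (induction arbitrary: K rule: chordal.induct)
  case (base M)
  then show ?case using PG_subgeometry_flat PG_modular_in by blast
next
  case (gpc M1 M2 P)
  note g = is_gpcD[OF gpc.hyps(3)]
  \<comment> \<open>The common part is projective inside both matroids, so the induction hypotheses
    make it modular in both; only then is \<open>P\<close> an \<open>amalgam\<close>.\<close>
  have "modular_in (flats M1) (gr M1 \<inter> gr M2)" "modular_in (flats M2) (gr M1 \<inter> gr M2)"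
    using gpc.IH(1)[OF Int_lower1] gpc.IH(2)[OF Int_lower2] g(7,8) by simp_all
  then interpret amalgam P M1 M2
    using g by unfold_locales auto
  have "flat P (gr M1)" "flat P (gr M2)"
    using modular_gr_M1 modular_gr_M2 by (simp_all add: modular_in_def flats_def)
  \<comment> \<open>\<open>K\<close> is covered by its traces on the two ground sets, which are
    flats of a projective geometry; one of them must be all of \<open>K\<close>.\<close>
  then have "flat (restr P K) (gr M1 \<inter> K)" "flat (restr P K) (gr M2 \<inter> K)"
    using flats_restr[OF P gpc.prems(1)] by (auto simp: flats_def)
  moreover have "(gr M1 \<inter> K) \<union> (gr M2 \<inter> K) = gr (restr P K)" using gpc.prems(1) gr_P by auto
  ultimately consider "K \<subseteq> gr M1" | "K \<subseteq> gr M2"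
    using PG_not_union[OF gpc.prems(2)] by auto
  then show ?case
  proof cases
    case 1
    show ?thesis by (rule PG_restr_modular[OF 1 gpc.prems(2) g(3) gpc.IH(1)[OF 1]])
  next
    case 2
    show ?thesis
      by (rule amalgam.PG_restr_modular[OF amalgam_swap[OF amalgam_axioms] 2 gpc.prems(2) g(4) gpc.IH(2)[OF 2]])
  qed
qed

text \<open>The theorem in a form that survives induction: restriction to a flat and contraction
  with simplification both yield intervals, and \<open>N\<close> carries arbitrary labels, being
  tied to \<open>M\<close> only through its lattice.\<close>

lemma chordal_ivl:
  fixes M N :: "'a matroid"
  shows "chordal TYPE('f::{finite,field}) M \<Longrightarrow> matroid N \<Longrightarrow> simple N \<Longrightarrow> flat M X \<Longrightarrow> flat M Y \<Longrightarrow>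
    X \<subseteq> Y \<Longrightarrow> isomorphic (flats N) (ivl (flats M) X Y) \<Longrightarrow> chordal TYPE('f) N"
proof (induction arbitrary: N X Y rule: chordal.induct)
  case (base M)
  have "is_PG TYPE('f) N"
    using base.prems by (intro is_PG_ivl[OF base.hyps, of X Y]) (auto simp: flats_def)
  then show ?case by (rule chordal.base)
next
  case (gpc M1 M2 P)
  note g = is_gpcD[OF gpc.hyps(3)]
  note N = gpc.prems(1,2) and XY = gpc.prems(3-5)
  let ?T = "gr M1 \<inter> gr M2"
  have "modular_in (flats M1) ?T" "modular_in (flats M2) ?T"
    using chordal_PG_modular[OF gpc.hyps(1) Int_lower1] chordal_PG_modular[OF gpc.hyps(2) Int_lower2] g(7,8)
    by simp_all
  then interpret amalgam P M1 M2
    using g by unfold_locales auto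
  obtain \<Phi> where \<Phi>: "order_iso \<Phi> (flats N) (ivl (flats P) X Y)"
    using gpc.prems(6) unfolding isomorphic_def by blast
  have ex: "\<exists>Z. flat N Z \<and> \<Phi> Z = cl P (X \<union> (Y \<inter> E))" for E
  proof -
    have "X \<union> (Y \<inter> E) \<subseteq> gr P" using XY by (auto simp: flat_def)
    then have "cl P (X \<union> (Y \<inter> E)) \<in> ivl (flats P) X Y"
      using flat_cl[OF P, of "X \<union> (Y \<inter> E)"] subset_cl[OF P, of "X \<union> (Y \<inter> E)"]
        cl_least[OF P _ XY(2), of "X \<union> (Y \<inter> E)"] XY(3) by (auto simp: ivl_def flats_def)
    from order_iso_surj[OF \<Phi> this] show ?thesis by (auto simp: flats_def)
  qed
  obtain Z1 where Z1: "flat N Z1" "\<Phi> Z1 = cl P (X \<union> (Y \<inter> gr M1))" using ex by blast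
  obtain Z2 where Z2: "flat N Z2" "\<Phi> Z2 = cl P (X \<union> (Y \<inter> gr M2))" using ex by blast
  note ctx = N \<Phi> XY Z1 Z2
  have Zgr: "Z1 \<subseteq> gr N" "Z2 \<subseteq> gr N" using Z1 Z2 by (auto simp: flat_def)
  have Z12: "flat N (Z1 \<inter> Z2)" by (rule flat_Int[OF N(1) Z1(1) Z2(1)])
  have mN: "matroid (restr N Z1)" "matroid (restr N Z2)" "simple (restr N Z1)" "simple (restr N Z2)"
    using matroid_restr[OF N(1)] simple_restr[OF N(2)] Zgr by auto
  have "isomorphic (flats (restr N Z1)) (ivl (flats M1) (X \<inter> gr M1) (Y \<inter> gr M1))"
    using restr_ivl_isomorphic[OF N \<Phi> P modular_gr_M1 XY Z1] unfolding flats_M1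
    by (simp add: ivl_ivl)
  then have c1: "chordal TYPE('f) (restr N Z1)"
    using XY flat_Int_gr(1) by (intro gpc.IH(1)[OF mN(1,3)]) auto
  have "isomorphic (flats (restr N Z2)) (ivl (flats M2) (X \<inter> gr M2) (Y \<inter> gr M2))"
    using restr_ivl_isomorphic[OF N \<Phi> P modular_gr_M2 XY Z2] unfolding flats_M2
    by (simp add: ivl_ivl)
  then have c2: "chordal TYPE('f) (restr N Z2)"
    using XY flat_Int_gr(2) by (intro gpc.IH(2)[OF mN(2,4)]) auto
  \<comment> \<open>The overlap of the pieces has as its lattice an interval of the projective
    geometry on the old common part, so it is again projective, the empty geometry included.\<close>
  have "isomorphic (flats (restr N (Z1 \<inter> Z2))) (ivl (flats P) (X \<inter> ?T) (Y \<inter> ?T))"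
    by (rule restr_ivl_isomorphic[OF N \<Phi> P modular_T XY Z12 ivl_meet[OF ctx]])
  moreover have fT: "flats (restr M1 ?T) = ivl (flats P) {} ?T"
    unfolding flats_restr_flat[OF M1 flat_T(1)] flats_M1 by (simp add: ivl_ivl)
  then have "ivl (flats P) (X \<inter> ?T) (Y \<inter> ?T) = ivl (flats (restr M1 ?T)) (X \<inter> ?T) (Y \<inter> ?T)"
    by (simp only: ivl_ivl empty_subsetI Int_lower2)
  moreover have "X \<inter> ?T \<in> flats (restr M1 ?T)" "Y \<inter> ?T \<in> flats (restr M1 ?T)" "X \<inter> ?T \<subseteq> Y \<inter> ?T"
  proof -
    have "flat P ?T" using modular_T by (simp add: modular_in_def flats_def)
    then show "X \<inter> ?T \<in> flats (restr M1 ?T)" "Y \<inter> ?T \<in> flats (restr M1 ?T)"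
      unfolding fT using flat_Int[OF P] XY by (auto simp: ivl_def flats_def)
    show "X \<inter> ?T \<subseteq> Y \<inter> ?T" using XY(3) by auto
  qed
  moreover have "matroid (restr N (Z1 \<inter> Z2))" "simple (restr N (Z1 \<inter> Z2))"
    using matroid_restr[OF N(1), of "Z1 \<inter> Z2"] simple_restr[OF N(2), of "Z1 \<inter> Z2"] Zgr by auto
  ultimately have PG: "is_PG TYPE('f) (restr N (Z1 \<inter> Z2))"
    by (intro is_PG_ivl[OF g(8), of "X \<inter> ?T" "Y \<inter> ?T"]) simp_all
  have fl: "flat N Z \<longleftrightarrow> flat (restr N Z1) (Z \<inter> Z1) \<and> flat (restr N Z2) (Z \<inter> Z2)" if "Z \<subseteq> gr N" for Z
  proof -
    have "flat (restr N Z1) (Z \<inter> Z1) \<longleftrightarrow> flat N (Z \<inter> Z1)" "flat (restr N Z2) (Z \<inter> Z2) \<longleftrightarrow> flat N (Z \<inter> Z2)"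
      using flats_restr_flat[OF N(1) Z1(1)] flats_restr_flat[OF N(1) Z2(1)]
      by (auto simp: flats_def ivl_def set_eq_iff)
    then show ?thesis using ivl_flat_iff[OF ctx that] by simp
  qed
  \<comment> \<open>Both pieces are restrictions of \<open>N\<close> itself, so they agree on their
    overlap by construction, and \<open>N\<close> is literally their parallel connection rather than
    only up to relabelling.\<close>
  have "is_gpc TYPE('f) N (restr N Z1) (restr N Z2)"
    unfolding is_gpc_def Let_def gr_restr restr_restr[OF Int_lower1] restr_restr[OF Int_lower2]
    using mN N(1) PG fl ivl_ground[OF ctx] modular_in_imp_modular_flat[OF mN(1) ivl_modular[OF ctx]]
    by (auto simp: flat_def)
  then show ?case by (rule chordal.gpc[OF c1 c2])
qed

section \<open>Contractions and simplifications\<close>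

context
  fixes M :: "'a matroid" and X :: "'a set"
  assumes M: "matroid M" and X: "X \<subseteq> gr M"
begin

lemma gr_contr: "gr (contr M X) = gr M - X"
  by (simp add: contr_def gr_def)

lemma indep_contr: "indep (contr M X) I \<longleftrightarrow> I \<subseteq> gr M - X \<and> rk M (I \<union> X) = card I + rk M X"
  by (simp add: contr_def indep_def)

lemma matroid_contr: "matroid (contr M X)"
  unfolding matroid_def gr_contr
proof (intro conjI allI impI)
  show "finite (gr M - X)" using finite_gr[OF M] by simp
  show "indep (contr M X) {}" by (simp add: indep_contr)
  show "I \<subseteq> gr M - X" if "indep (contr M X) I" for I using that by (simp add: indep_contr)
next
  fix I J assume IJ: "indep (contr M X) I \<and> J \<subseteq> I"
  then have I: "I \<subseteq> gr M - X" "rk M (I \<union> X) = card I + rk M X" by (auto simp: indep_contr)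
  have fin: "finite I" by (rule finite_subset[OF I(1)]) (simp add: finite_gr[OF M])
  have finJ: "finite J" using IJ fin finite_subset by blast
  have "X \<union> J \<union> (I - J) = I \<union> X" using IJ by auto
  then have "rk M (I \<union> X) \<le> rk M (X \<union> J) + card (I - J)"
    using rk_Un_le[OF M, of "I - J" "X \<union> J"] fin by simp
  moreover have "rk M (X \<union> J) \<le> rk M X + card J" by (rule rk_Un_le[OF M finJ])
  moreover have "card (I - J) = card I - card J" "card J \<le> card I"
    using IJ fin finJ by (auto simp: card_Diff_subset card_mono)
  ultimately have "rk M (J \<union> X) = card J + rk M X" using I(2) by (simp add: Un_commute)
  then show "indep (contr M X) J" using IJ I(1) by (auto simp: indep_contr)
next
  fix I J assume IJ: "indep (contr M X) I \<and> indep (contr M X) J \<and> card I < card J"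
  then have I: "I \<subseteq> gr M - X" "rk M (I \<union> X) = card I + rk M X"
    and J: "J \<subseteq> gr M - X" "rk M (J \<union> X) = card J + rk M X" by (auto simp: indep_contr)
  have fin: "finite I" "finite J" using I(1) J(1) finite_gr[OF M] by (auto intro: finite_subset)
  \<comment> \<open>If every element of \<open>J\<close> were spanned by
    \<open>I \<union> X\<close>, the rank of \<open>J \<union> X\<close> could not exceed that of
    \<open>I \<union> X\<close>, although \<open>J\<close> is larger than \<open>I\<close>.\<close>
  have "\<exists>y\<in>J. rk M (insert y (I \<union> X)) \<noteq> rk M (I \<union> X)"
  proof (rule ccontr)
    assume "\<not> ?thesis"
    then have "rk M (I \<union> X \<union> J) = rk M (I \<union> X)" by (intro rk_Un_eq[OF M fin(2)]) auto
    moreover have "rk M (J \<union> X) \<le> rk M (I \<union> X \<union> J)" by (rule rk_mono[OF M]) auto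
    ultimately show False using IJ I(2) J(2) by simp
  qed
  then obtain y where y: "y \<in> J" "rk M (insert y (I \<union> X)) \<noteq> rk M (I \<union> X)" by blast
  have yI: "y \<notin> I" using y(2) by (auto simp: insert_absorb)
  have "rk M (insert y I \<union> X) = card (insert y I) + rk M X"
    using y(2) rk_le_insert[OF M, of "I \<union> X" y] rk_insert_le[OF M, of y "I \<union> X"] I(2) fin(1) yI by simp
  then have "indep (contr M X) (insert y I)" using I(1) J(1) y(1) by (auto simp: indep_contr)
  then show "\<exists>y\<in>J - I. indep (contr M X) (insert y I)" using y(1) yI by blast
qed

text \<open>For the upper bound, extend a basis of \<open>X\<close> to a basis of
  \<open>A \<union> X\<close>; what lies outside \<open>X\<close> is independent in the
  contraction.\<close>

lemma rk_contr:
  assumes A: "A \<subseteq> gr M - X"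
  shows "rk M (A \<union> X) = rk (contr M X) A + rk M X"
proof (rule antisym)
  obtain I where I: "I \<subseteq> A" "indep (contr M X) I" "card I = rk (contr M X) A"
    using rk_attained[OF matroid_contr] by blast
  have "rk M (I \<union> X) \<le> rk M (A \<union> X)" using I(1) by (intro rk_mono[OF M]) auto
  then show "rk (contr M X) A + rk M X \<le> rk M (A \<union> X)" using I(2,3) by (simp add: indep_contr)
  obtain B where B: "B \<subseteq> X" "indep M B" "card B = rk M X"
    using rk_attained[OF M] by blast
  obtain J where J: "B \<subseteq> J" "J \<subseteq> A \<union> X" "indep M J" "card J = rk M (A \<union> X)"
    using indep_extend[OF M B(2), of "A \<union> X"] B(1) by auto
  have fin: "finite J" by (rule indep_finite[OF M J(3)])
  have "card (J \<inter> X) = rk M X"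
  proof (rule antisym)
    show "card (J \<inter> X) \<le> rk M X" using card_le_rk[OF M indep_mono[OF M J(3)]] by simp
    show "rk M X \<le> card (J \<inter> X)" unfolding B(3)[symmetric] using B(1) J(1) fin by (intro card_mono) auto
  qed
  then have cJ: "card J = rk M X + card (J - X)"
    using card_Int_Diff[OF fin, of X] by simp
  have "rk M (J - X \<union> X) \<le> rk M X + card (J - X)"
    using rk_Un_le[OF M, of "J - X" X] fin by (simp add: Un_commute)
  moreover have "card J \<le> rk M (J - X \<union> X)" by (rule card_le_rk[OF M J(3)]) auto
  ultimately have "rk M (J - X \<union> X) = card (J - X) + rk M X" using cJ by simp
  then have "indep (contr M X) (J - X)" using J(2) A by (auto simp: indep_contr)
  then have "card (J - X) \<le> rk (contr M X) A"
    using J(2) by (intro card_le_rk[OF matroid_contr]) auto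
  then show "rk M (A \<union> X) \<le> rk (contr M X) A + rk M X" using J(4) cJ by simp
qed

lemma cl_contr: "A \<subseteq> gr M - X \<Longrightarrow> cl (contr M X) A = cl M (A \<union> X) - X"
proof -
  assume A: "A \<subseteq> gr M - X"
  have "rk (contr M X) (insert e A) = rk (contr M X) A \<longleftrightarrow> rk M (insert e (A \<union> X)) = rk M (A \<union> X)"
    if "e \<in> gr M - X" for e
    using rk_contr[OF A] rk_contr[of "insert e A"] A that by auto
  then show ?thesis unfolding cl_def gr_contr by auto
qed

lemma flats_contr: "flats (contr M X) = (\<lambda>F. F - X) ` ivl (flats M) X (gr M)"
proof (intro equalityI subsetI)
  fix G assume "G \<in> flats (contr M X)"
  then have G: "G \<subseteq> gr M - X" "G = cl M (G \<union> X) - X"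
    using cl_contr[of G] by (auto simp: flats_def flat_def gr_contr)
  have GX: "G \<union> X \<subseteq> gr M" using G(1) X by auto
  then have "cl M (G \<union> X) \<in> ivl (flats M) X (gr M)"
    using flat_cl[OF M GX] subset_cl[OF M GX] cl_subset_gr[OF M] by (auto simp: ivl_def flats_def)
  then show "G \<in> (\<lambda>F. F - X) ` ivl (flats M) X (gr M)" using G(2) by blast
next
  fix G assume "G \<in> (\<lambda>F. F - X) ` ivl (flats M) X (gr M)"
  then obtain F where F: "flat M F" "X \<subseteq> F" "G = F - X" by (auto simp: ivl_def flats_def)
  have "G \<union> X = F" using F by auto
  moreover have "G \<subseteq> gr M - X" using F by (auto simp: flat_def)
  ultimately show "G \<in> flats (contr M X)"
    using cl_contr[of G] F by (simp add: flats_def flat_def gr_contr)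
qed

end

text \<open>A flat is determined by the representatives it contains: a non-loop has the same closure
  as its representative, and a loop lies in every flat. So intersecting with \<open>S\<close> is an
  order isomorphism.\<close>

lemma flats_simplification:
  assumes C: "matroid C" and N: "is_simplification C N"
  shows "matroid N" "simple N" "isomorphic (flats C) (flats N)"
proof -
  obtain S where S: "S \<subseteq> gr C" "\<And>s. s \<in> S \<Longrightarrow> indep C {s}"
    "\<And>e. e \<in> gr C \<Longrightarrow> indep C {e} \<Longrightarrow> \<exists>!s. s \<in> S \<and> cl C {s} = cl C {e}"
    and N_eq: "N = restr C S"
    using N unfolding is_simplification_def by auto
  show "matroid N" unfolding N_eq by (rule matroid_restr[OF C S(1)])
  \<comment> \<open>Closures of single representatives are flats of rank one, so containment between
    them is equality, and uniqueness of the representative applies.\<close>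
  have parallel: "s = t" if s: "s \<in> S" and t: "t \<in> S" and st: "s \<in> cl C {t}" for s t
  proof -
    have gr: "{s} \<subseteq> gr C" "{t} \<subseteq> gr C" using s t S(1) by auto
    have "rk C {s} = 1" "rk C {t} = 1"
      using S(2)[OF s] S(2)[OF t] indep_iff_rk[OF C gr(1)] indep_iff_rk[OF C gr(2)] by simp_all
    then have "rk C (cl C {s}) = rk C (cl C {t})" using rk_cl[OF C] gr by simp
    moreover have "cl C {s} \<subseteq> cl C {t}" using st by (intro cl_least[OF C _ flat_cl[OF C gr(2)]]) simp
    ultimately have "cl C {s} = cl C {t}"
      using flat_rk_less[OF C flat_cl[OF C gr(1)], of "cl C {t}"] cl_subset_gr[OF C] by auto
    then show "s = t" using S(3)[of t] S(2)[OF t] s t gr by auto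
  qed
  have "indep C {s, t}" if s: "s \<in> S" and t: "t \<in> S" for s t
  proof (cases "s = t")
    case False
    have "{s, t} \<subseteq> gr C" using s t S(1) by auto
    moreover have "s \<notin> cl C {t}" "t \<notin> cl C {s}" using parallel[OF s t] parallel[OF t s] False by auto
    moreover have "{s, t} - {s} = {t}" "{s, t} - {t} = {s}" using False by auto
    ultimately show ?thesis using indep_iff_cl[OF C, of "{s, t}"] by simp
  qed (use S(2)[OF s] in simp)
  then show "simple N" unfolding simple_def N_eq by simp
  have le: "F \<subseteq> G" if F: "flat C F" and G: "flat C G" and FG: "F \<inter> S \<subseteq> G \<inter> S" for F G
  proof
    fix e assume e: "e \<in> F"
    then have eg: "e \<in> gr C" using F by (auto simp: flat_def)
    show "e \<in> G"
    proof (cases "indep C {e}")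
      case True
      obtain s where s: "s \<in> S" "cl C {s} = cl C {e}" using S(3)[OF eg True] by auto
      have "s \<in> cl C {s}" "e \<in> cl C {e}"
        using subset_cl[OF C, of "{s}"] subset_cl[OF C, of "{e}"] s(1) S(1) eg by auto
      then have "s \<in> F" using cl_least[OF C _ F, of "{e}"] e s(2) by auto
      then have "s \<in> G" using FG s(1) by auto
      then have "cl C {s} \<subseteq> G" by (intro cl_least[OF C _ G]) simp
      then show ?thesis using \<open>e \<in> cl C {e}\<close> s(2) by auto
    next
      case False
      then have "e \<in> cl C {}" using indep_iff_cl[OF C, of "{e}"] eg by simp
      then show ?thesis using cl_least[OF C _ G, of "{}"] by auto
    qed
  qed
  have "(\<lambda>F. F \<inter> S) ` flats C = flats N" unfolding N_eq using flats_restr[OF C S(1)] by simp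
  moreover have "F \<inter> S \<subseteq> G \<inter> S \<longleftrightarrow> F \<subseteq> G" if "F \<in> flats C" "G \<in> flats C" for F G
    using le[of F G] that by (auto simp: flats_def)
  ultimately have "order_iso (\<lambda>F. F \<inter> S) (flats C) (flats N)" by (rule order_iso_imageI)
  then show "isomorphic (flats C) (flats N)" unfolding isomorphic_def by blast
qed

text \<open>Flats above \<open>X\<close> are the flats above \<open>cl M X\<close>; the closure is
  used so that the lower end of the interval is itself a flat.\<close>

lemma isomorphic_contr:
  assumes M: "matroid M" and X: "X \<subseteq> gr M"
  shows "isomorphic (flats (contr M X)) (ivl (flats M) (cl M X) (gr M))"
proof -
  have "ivl (flats M) (cl M X) (gr M) = ivl (flats M) X (gr M)"
    using cl_least[OF M, of X] subset_cl[OF M X] by (auto simp: ivl_def flats_def)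
  moreover have "order_iso (\<lambda>F. F - X) (ivl (flats M) X (gr M)) (flats (contr M X))"
    by (rule order_iso_imageI) (auto simp: flats_contr[OF M X] ivl_def)
  then have "isomorphic (ivl (flats M) X (gr M)) (flats (contr M X))"
    unfolding isomorphic_def by blast
  ultimately show ?thesis using isomorphic_sym by simp
qed

section \<open>Induced minors\<close>

theorem theorem1p2:
  fixes M N :: "'a matroid"
  assumes "chordal TYPE('f::{finite,field}) M"
    and "induced_minor M N"
  shows "chordal TYPE('f) N"
  using assms(2)
proof (induction rule: induced_minor.induct)
  case refl
  show ?case by (rule assms(1))
next
  case (restrict N X)
  have N: "matroid N" "simple N" using chordal_matroid_simple[OF restrict.IH] by auto
  have X: "X \<subseteq> gr N" using restrict.hyps by (simp add: flat_def)
  have "order_iso id (flats (restr N X)) (ivl (flats N) {} X)"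
    unfolding flats_restr_flat[OF N(1) restrict.hyps(2)] by (simp add: order_iso_def)
  then have "isomorphic (flats (restr N X)) (ivl (flats N) {} X)"
    unfolding isomorphic_def by blast
  \<comment> \<open>Chordal matroids are simple, so the empty set is a flat and can be the lower end
    of the interval.\<close>
  moreover have "flat N {}" using N simple_iff_flats[OF N(1)] by blast
  ultimately show ?case
    using chordal_ivl[OF restrict.IH matroid_restr[OF N(1) X] simple_restr[OF N(2) X]] restrict.hyps(2)
    by blast
next
  case (contract N X N')
  have N: "matroid N" using chordal_matroid_simple[OF contract.IH] by auto
  note s = flats_simplification[OF matroid_contr[OF N contract.hyps(2)] contract.hyps(3)]
  have "isomorphic (flats N') (ivl (flats N) (cl N X) (gr N))"
    by (rule isomorphic_trans[OF isomorphic_sym[OF s(3)] isomorphic_contr[OF N contract.hyps(2)]])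
  then show ?case
    by (intro chordal_ivl[OF contract.IH s(1,2) flat_cl[OF N contract.hyps(2)] flat_gr[OF N] cl_subset_gr[OF N]])
qed

end
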